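(* Let $\Bbbk\in\{\mathbb{R},\mathbb{C}\}$, let $\mathcal{X}\subseteq\Bbbk^n$ be a model given as in (IS) or (ES), let $d=\dim\mathcal{X}$, let $\Delta(\mathcal{X})=\{x_1-x_2:x_1,x_2\in\mathcal{X}\}\subseteq\Bbbk^n$, and let $\mu=\hat\mu|_{\mathcal X}:\mathcal{X}\to\Bbbk^s$ be the restriction of a generic linear map $\hat\mu:\Bbbk^n\to\Bbbk^s$. If $s\ge1+\dim\Delta(\mathcal{X})$, then $\mu$ is everywhere identifiable. In particular, if $s\ge2d+1$, then $\mu$ is everywhere identifiable.
   Context: The model is given in one of two ways. (IS): $\mathcal{X}=\{x\in\Bbbk^n: f_1(x)=\dots=f_k(x)=0\}$ for polynomials $f_i\in\Bbbk[x_1,\dots,x_n]$; in this case $\mathcal X$ is assumed irreducible (nonempty and not a union of two proper algebraic subvarieties). (ES): $\mathcal{X}=\phi(\Bbbk^\ell)$ for a polynomial map $\phi:\Bbbk^\ell\to\Bbbk^n$ (the Zariski closure is then automatically irreducible). The dimension of $\mathcal{X}$ (respectively of $\Delta(\mathcal X)$) is the dimension, as an algebraic variety over $\Bbbk$, of its Zariski closure in $\Bbbk^n$. The map $\mu$ is identifiable at $x\in\mathcal{X}$ if $\mu^{-1}(\mu(x))=\{x\}$, and everywhere identifiable if this holds for every $x\in\mathcal{X}$. A property holds for a generic linear map if it holds for all linear maps in some nonempty Zariski open subset of $\Bbbk^{s\times n}$. *)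

theory Defs
  imports
    "HOL-Analysis.Analysis"
    "HOL-Algebra.QuotRing"
    "HOL-Library.Poly_Mapping"
    "HOL-Library.Extended_Nat"
begin

section \<open>Polynomials and algebraic sets\<close>

text \<open>A polynomial over the ring \<open>'k\<close> in variables indexed by \<open>'v\<close> is a finitely supported map from
  exponent vectors to coefficients; multiplication is the convolution product of \<^typ>\<open>'a \<Rightarrow>\<^sub>0 'b\<close>.\<close>

type_synonym ('v, 'k) mpoly = "('v \<Rightarrow>\<^sub>0 nat) \<Rightarrow>\<^sub>0 'k"

definition mpoly_eval :: "('v::finite, 'k::comm_ring_1) mpoly \<Rightarrow> 'k ^ 'v \<Rightarrow> 'k" where
  "mpoly_eval p x =
     (\<Sum>m \<in> Poly_Mapping.keys p. Poly_Mapping.lookup p m * (\<Prod>i\<in>UNIV. (x $ i) ^ Poly_Mapping.lookup m i))"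

definition algebraic_set :: "('k::comm_ring_1 ^ 'n::finite) set \<Rightarrow> bool" where
  "algebraic_set V \<longleftrightarrow>
     (\<exists>F :: ('n, 'k) mpoly set. finite F \<and> V = {x. \<forall>f\<in>F. mpoly_eval f x = 0})"

definition irreducible_set :: "('k::comm_ring_1 ^ 'n::finite) set \<Rightarrow> bool" where
  "irreducible_set V \<longleftrightarrow>
     V \<noteq> {} \<and> \<not> (\<exists>A B. algebraic_set A \<and> algebraic_set B \<and> A \<subset> V \<and> B \<subset> V \<and> V = A \<union> B)"

definition polynomial_map :: "('k::comm_ring_1 ^ 'l::finite \<Rightarrow> 'k ^ 'n::finite) \<Rightarrow> bool" where
  "polynomial_map \<phi> \<longleftrightarrow>
     (\<exists>f :: 'n \<Rightarrow> ('l, 'k) mpoly. \<forall>t. \<phi> t = (\<chi> i. mpoly_eval (f i) t))"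

definition zariski_closure :: "('k::comm_ring_1 ^ 'n::finite) set \<Rightarrow> ('k ^ 'n) set" where
  "zariski_closure X = \<Inter> {V. algebraic_set V \<and> X \<subseteq> V}"

section \<open>Dimension\<close>

definition vanishing_ideal :: "('k::comm_ring_1 ^ 'n::finite) set \<Rightarrow> ('n, 'k) mpoly set" where
  "vanishing_ideal X = {p. \<forall>x\<in>X. mpoly_eval p x = 0}"

definition mpoly_ring :: "('v, 'k::comm_ring_1) mpoly ring" where
  "mpoly_ring = \<lparr>carrier = UNIV, monoid.mult = (*), one = 1, ring.zero = 0, add = (+)\<rparr>"

definition coordinate_ring :: "('k::comm_ring_1 ^ 'n::finite) set \<Rightarrow> ('n, 'k) mpoly set ring" where
  "coordinate_ring V = mpoly_ring Quot (vanishing_ideal V)"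

text \<open>The supremum of the lengths of chains \<open>P 0 \<subset> \<dots> \<subset> P m\<close> of prime ideals. It lives in \<^typ>\<open>enat\<close> so that
  it is meaningful without a proof that the lengths are bounded. The zero ring, which has no
  prime ideals, gets the value \<open>0\<close>.\<close>

definition krull_dim :: "('a, 'b) ring_scheme \<Rightarrow> enat" where
  "krull_dim R =
     Sup {enat m | m. \<exists>P :: nat \<Rightarrow> 'a set.
        (\<forall>i\<le>m. primeideal (P i) R) \<and> (\<forall>i<m. P i \<subset> P (Suc i))}"

text \<open>The dimension of a variety over \<open>'k\<close> is the Krull dimension of its coordinate ring
  \<open>'k[x]/I(V)\<close>. The prime ideals are not required to be vanishing ideals of sets of
  \<open>'k\<close>-points, so this is the usual notion over non-closed fields as well.\<close>

definition alg_dim :: "('k::comm_ring_1 ^ 'n::finite) set \<Rightarrow> enat" where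
  "alg_dim X = krull_dim (coordinate_ring (zariski_closure X))"

section \<open>Generic linear maps and identifiability\<close>

definition difference_set :: "('k::comm_ring_1 ^ 'n::finite) set \<Rightarrow> ('k ^ 'n) set" where
  "difference_set X = {x1 - x2 | x1 x2. x1 \<in> X \<and> x2 \<in> X}"

text \<open>The entries of an \<open>'s \<times> 'n\<close> matrix are the coordinates of an affine space indexed by pairs;
  this is the space that carries the Zariski topology.\<close>

definition matrix_of_vec :: "'k ^ ('s::finite \<times> 'n::finite) \<Rightarrow> 'k ^ 'n ^ 's" where
  "matrix_of_vec u = (\<chi> i j. u $ (i, j))"

definition zariski_open :: "('k::comm_ring_1 ^ 'n::finite) set \<Rightarrow> bool" where
  "zariski_open U \<longleftrightarrow> algebraic_set (- U)"

definition generic_linear :: "('k::comm_ring_1 ^ 'n::finite ^ 's::finite \<Rightarrow> bool) \<Rightarrow> bool" where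
  "generic_linear P \<longleftrightarrow>
     (\<exists>U :: ('k ^ ('s \<times> 'n)) set. zariski_open U \<and> U \<noteq> {} \<and> (\<forall>u\<in>U. P (matrix_of_vec u)))"

definition identifiable_at :: "('a \<Rightarrow> 'b) \<Rightarrow> 'a set \<Rightarrow> 'a \<Rightarrow> bool" where
  "identifiable_at \<mu> X x \<longleftrightarrow> {y \<in> X. \<mu> y = \<mu> x} = {x}"

definition everywhere_identifiable :: "('a \<Rightarrow> 'b) \<Rightarrow> 'a set \<Rightarrow> bool" where
  "everywhere_identifiable \<mu> X \<longleftrightarrow> (\<forall>x\<in>X. identifiable_at \<mu> X x)"

end

theory Submission
  imports Defs "HOL-Computational_Algebra.Polynomial"
begin

text \<open>A linear map fails to be injective on \<open>X\<close> exactly when its kernel contains a nonzero point of the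
  difference set \<open>\<Delta>\<close>. The matrices that kill some \<open>z \<in> \<Delta>\<close> with \<open>z\<^sub>j \<noteq> 0\<close> are parametrized by
  \<open>z\<close> together with \<open>n - 1\<close> free columns, that is by \<open>dim \<Delta> + s * (n - 1)\<close> parameters. If
  \<open>dim \<Delta> < s\<close> this is less than \<open>s * n\<close>, so these matrices satisfy a nontrivial polynomial equation.
  A matrix that violates the product of these equations over all \<open>j\<close> is injective on \<open>X\<close>.

  The dimension count is carried out with Hilbert functions. If a set \<open>Z\<close> has growth at most \<open>d\<close> (\<open>growth_le\<close>),
  comparing the number of monomials in the matrix entries with the dimension of the space of their pullbacks gives
  the equation by plain linear algebra (\<open>generic_matrix_avoids_kernel_param\<close>). The growth of a difference set is at
  most twice that of the set itself (\<open>growth_le_difference_set\<close>), which accounts for the bound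
  \<open>2 * d + 1\<close>.

  It remains to compare growth with the Krull dimension. For irreducible \<open>V\<close>, take a largest set \<open>T\<close> of coordinates
  that are algebraically independent on \<open>V\<close>. Each other coordinate satisfies a polynomial equation over those in \<open>T\<close>. On the
  dense part of \<open>V\<close> where no leading coefficient of these equations vanishes, the growth is at most \<open>card T\<close> (\<open>growth_le_of_maximal_alg_indep\<close>). Conversely,
  independent coordinates produce a chain of primes of length \<open>card T\<close> (\<open>exists_chain_of_prime_ideals\<close>): cutting
  with a suitable hyperplane \<open>x\<^sub>v = a\<close> keeps the remaining coordinates independent. Such a hyperplane exists because
  the field is uncountable (\<open>exists_hyperplane_section_avoiding\<close>). All this applies to \<open>X\<close> and to its
  difference set, since irreducibility passes from \<open>X\<close> to \<open>\<Delta>\<close>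
  (\<open>zariski_irreducible_difference_set\<close>).\<close>

section \<open>Polynomial functions\<close>

lemma mpoly_eval_superset:
  assumes "finite K" "Poly_Mapping.keys p \<subseteq> K"
  shows "mpoly_eval p x =
    (\<Sum>m\<in>K. Poly_Mapping.lookup p m * (\<Prod>i\<in>UNIV. (x $ i) ^ Poly_Mapping.lookup m i))"
  unfolding mpoly_eval_def
  by (rule sum.mono_neutral_left) (use assms in \<open>auto simp: in_keys_iff\<close>)

lemma mpoly_eval_add: "mpoly_eval (p + q) x = mpoly_eval p x + mpoly_eval q x"
proof -
  let ?K = "Poly_Mapping.keys p \<union> Poly_Mapping.keys q"
  have "finite ?K" by simp
  then show ?thesis
    by (subst (1 2 3) mpoly_eval_superset[of ?K])
       (auto simp: keys_add lookup_add distrib_right sum.distrib)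
qed

lemma mpoly_eval_zero [simp]: "mpoly_eval 0 x = 0"
  by (simp add: mpoly_eval_def)

lemma mpoly_eval_sum: "mpoly_eval (sum f A) x = (\<Sum>a\<in>A. mpoly_eval (f a) x)"
  by (induction A rule: infinite_finite_induct) (auto simp: mpoly_eval_add)

lemma mpoly_eval_single:
  "mpoly_eval (Poly_Mapping.single m c) x = c * (\<Prod>i\<in>UNIV. (x $ i) ^ Poly_Mapping.lookup m i)"
  by (subst mpoly_eval_superset[of "{m}"]) (auto simp: lookup_single)

lemma poly_mapping_sum_singles:
  "p = (\<Sum>m\<in>Poly_Mapping.keys p. Poly_Mapping.single m (Poly_Mapping.lookup p m))"
proof (rule poly_mapping_eqI)
  fix k
  have "Poly_Mapping.lookup (\<Sum>m\<in>Poly_Mapping.keys p. Poly_Mapping.single m (Poly_Mapping.lookup p m)) k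
     = (\<Sum>m\<in>Poly_Mapping.keys p. if m = k then Poly_Mapping.lookup p k else 0)"
    unfolding lookup_sum by (rule sum.cong) (auto simp: lookup_single)
  then show "Poly_Mapping.lookup p k = Poly_Mapping.lookup (\<Sum>m\<in>Poly_Mapping.keys p. Poly_Mapping.single m (Poly_Mapping.lookup p m)) k"
    by (auto simp: in_keys_iff)
qed

lemma mpoly_eval_mult: "mpoly_eval (p * q) x = mpoly_eval p x * mpoly_eval q x"
proof -
  let ?s = "\<lambda>p m. Poly_Mapping.single m (Poly_Mapping.lookup p m)"
  have *: "mpoly_eval (?s p m * ?s q n) x = mpoly_eval (?s p m) x * mpoly_eval (?s q n) x" for m n
    by (simp add: mult_single mpoly_eval_single lookup_add power_add prod.distrib mult_ac)
  have "mpoly_eval (p * q) x = mpoly_eval ((\<Sum>m\<in>Poly_Mapping.keys p. ?s p m) * (\<Sum>m\<in>Poly_Mapping.keys q. ?s q m)) x"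
    by (simp flip: poly_mapping_sum_singles)
  also have "\<dots> = (\<Sum>m\<in>Poly_Mapping.keys p. mpoly_eval (?s p m) x) * (\<Sum>m\<in>Poly_Mapping.keys q. mpoly_eval (?s q m) x)"
    by (simp add: sum_product mpoly_eval_sum *)
  also have "\<dots> = mpoly_eval p x * mpoly_eval q x"
    by (simp flip: poly_mapping_sum_singles mpoly_eval_sum)
  finally show ?thesis .
qed

abbreviation mConst :: "'k::comm_ring_1 \<Rightarrow> ('v, 'k) mpoly" where
  "mConst c \<equiv> Poly_Mapping.single 0 c"

definition mVar :: "'v \<Rightarrow> ('v, 'k::comm_ring_1) mpoly" where
  "mVar v = Poly_Mapping.single (Poly_Mapping.single v 1) 1"

lemma mpoly_eval_mConst [simp]: "mpoly_eval (mConst c) x = c"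
  by (simp add: mpoly_eval_single)

lemma mpoly_eval_one [simp]: "mpoly_eval 1 x = 1"
  using mpoly_eval_mConst[of 1 x] by simp

lemma mpoly_eval_mVar [simp]: "mpoly_eval (mVar v) x = x $ v"
proof -
  have "(\<Prod>i\<in>UNIV. (x $ i) ^ Poly_Mapping.lookup (Poly_Mapping.single v (1::nat)) i)
      = (\<Prod>i\<in>UNIV. if i = v then x $ v else 1)"
    by (rule prod.cong) (auto simp: lookup_single)
  then show ?thesis by (simp add: mVar_def mpoly_eval_single)
qed

lemma mpoly_eval_uminus: "mpoly_eval (- p) x = - mpoly_eval p x"
  using mpoly_eval_add[of p "- p" x] by (simp add: eq_neg_iff_add_eq_0 add.commute)

lemma mpoly_eval_diff: "mpoly_eval (p - q) x = mpoly_eval p x - mpoly_eval q x"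
  using mpoly_eval_add[of p "- q" x] by (simp add: mpoly_eval_uminus)

lemma mpoly_eval_prod: "mpoly_eval (prod f A) x = (\<Prod>a\<in>A. mpoly_eval (f a) x)"
  by (induction A rule: infinite_finite_induct) (auto simp: mpoly_eval_mult)

definition is_poly :: "('k::comm_ring_1 ^ 'v::finite \<Rightarrow> 'k) \<Rightarrow> bool" where
  "is_poly f \<longleftrightarrow> (\<exists>p. \<forall>x. f x = mpoly_eval p x)"

named_theorems is_poly_intros

lemma is_poly_mpoly_eval [is_poly_intros]: "is_poly (mpoly_eval p)"
  by (auto simp: is_poly_def)

lemma is_poly_const [is_poly_intros]: "is_poly (\<lambda>x. c)"
  unfolding is_poly_def by (rule exI[of _ "mConst c"]) simp

lemma is_poly_coord [is_poly_intros]: "is_poly (\<lambda>x. x $ v)"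
  unfolding is_poly_def by (rule exI[of _ "mVar v"]) simp

lemma is_poly_add [is_poly_intros]: "is_poly f \<Longrightarrow> is_poly g \<Longrightarrow> is_poly (\<lambda>x. f x + g x)"
  unfolding is_poly_def by (metis mpoly_eval_add)

lemma is_poly_diff [is_poly_intros]: "is_poly f \<Longrightarrow> is_poly g \<Longrightarrow> is_poly (\<lambda>x. f x - g x)"
  unfolding is_poly_def by (metis mpoly_eval_diff)

lemma is_poly_uminus [is_poly_intros]: "is_poly f \<Longrightarrow> is_poly (\<lambda>x. - f x)"
  unfolding is_poly_def by (metis mpoly_eval_uminus)

lemma is_poly_mult [is_poly_intros]: "is_poly f \<Longrightarrow> is_poly g \<Longrightarrow> is_poly (\<lambda>x. f x * g x)"
  unfolding is_poly_def by (metis mpoly_eval_mult)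

lemma is_poly_power [is_poly_intros]: "is_poly f \<Longrightarrow> is_poly (\<lambda>x. f x ^ n)"
  by (induction n) (auto intro: is_poly_intros)

lemma is_poly_sum [is_poly_intros]:
  "(\<And>a. a \<in> A \<Longrightarrow> is_poly (f a)) \<Longrightarrow> is_poly (\<lambda>x. \<Sum>a\<in>A. f a x)"
  by (induction A rule: infinite_finite_induct) (auto intro: is_poly_intros)

lemma is_poly_prod [is_poly_intros]:
  "(\<And>a. a \<in> A \<Longrightarrow> is_poly (f a)) \<Longrightarrow> is_poly (\<lambda>x. \<Prod>a\<in>A. f a x)"
  by (induction A rule: infinite_finite_induct) (auto intro: is_poly_intros)

lemma is_poly_compose:
  assumes "is_poly f" "\<And>i. is_poly (\<lambda>x. \<phi> x $ i)"
  shows "is_poly (\<lambda>x. f (\<phi> x))"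
proof -
  obtain p where "\<And>x. f x = mpoly_eval p x" using assms by (auto simp: is_poly_def)
  then show ?thesis
    by (simp add: mpoly_eval_def) (intro is_poly_intros assms(2))
qed

lemma is_poly_restrict_line:
  fixes f :: "'k::field_char_0 ^ 'v::finite \<Rightarrow> 'k"
  assumes "is_poly f"
  shows "\<exists>P. \<forall>t. f (\<chi> i. x $ i + t * (y $ i - x $ i)) = poly P t"
proof -
  obtain p where p: "\<And>x. f x = mpoly_eval p x" using assms by (auto simp: is_poly_def)
  show ?thesis
    by (rule exI[of _ "\<Sum>m\<in>Poly_Mapping.keys p. [:Poly_Mapping.lookup p m:] *
        (\<Prod>i\<in>UNIV. [:x $ i, y $ i - x $ i:] ^ Poly_Mapping.lookup m i)"])
       (simp add: p mpoly_eval_def poly_sum poly_prod)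
qed

text \<open>On a line through a point where \<open>f\<close> does not vanish and a point where \<open>g\<close> does not vanish,
  both restrict to nonzero polynomials in one variable.\<close>

lemma is_poly_no_zero_divisors:
  fixes f g :: "'k::field_char_0 ^ 'v::finite \<Rightarrow> 'k"
  assumes "is_poly f" "is_poly g" "f x \<noteq> 0" "g y \<noteq> 0"
  shows "\<exists>z. f z * g z \<noteq> 0"
proof (rule ccontr)
  assume *: "\<nexists>z. f z * g z \<noteq> 0"
  obtain P where P: "\<And>t. f (\<chi> i. x $ i + t * (y $ i - x $ i)) = poly P t"
    using is_poly_restrict_line[OF assms(1)] by blast
  obtain Q where Q: "\<And>t. g (\<chi> i. x $ i + t * (y $ i - x $ i)) = poly Q t"
    using is_poly_restrict_line[OF assms(2)] by blast
  have "poly (P * Q) t = 0" for t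
    using * unfolding poly_mult P[symmetric] Q[symmetric] by blast
  then have "P * Q = 0" using poly_all_0_iff_0 by blast
  moreover have "P \<noteq> 0" using P[of 0] assms by auto
  moreover have "Q \<noteq> 0" using Q[of 1] assms by auto
  ultimately show False by simp
qed

lemma is_poly_prod_nonzero:
  fixes f :: "'a \<Rightarrow> 'k::field_char_0 ^ 'v::finite \<Rightarrow> 'k"
  assumes "finite A" "\<And>a. a \<in> A \<Longrightarrow> is_poly (f a) \<and> (\<exists>x. f a x \<noteq> 0)"
  shows "\<exists>x. (\<Prod>a\<in>A. f a x) \<noteq> 0"
  using assms
proof (induction A rule: finite_induct)
  case (insert a A)
  then obtain x y where xy: "(\<Prod>a\<in>A. f a x) \<noteq> 0" "f a y \<noteq> 0" by blast
  have "is_poly (f a)" "is_poly (\<lambda>x. \<Prod>a\<in>A. f a x)"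
    using insert.prems by (auto intro: is_poly_prod)
  from is_poly_no_zero_divisors[OF this xy(2,1)] show ?case using insert.hyps by simp
qed simp

section \<open>Linear algebra\<close>

lemma nontrivial_solution_of_homogeneous_system:
  fixes a :: "'i \<Rightarrow> 'j \<Rightarrow> 'k::field"
  assumes "finite J" "finite I" "card J < card I"
  shows "\<exists>l. (\<exists>i\<in>I. l i \<noteq> 0) \<and> (\<forall>j\<in>J. (\<Sum>i\<in>I. l i * a i j) = 0)"
  using assms
proof (induction J arbitrary: I a rule: finite_induct)
  case empty
  then obtain i where "i \<in> I" by fastforce
  then show ?case by (intro exI[of _ "\<lambda>_. 1"]) auto
next
  case (insert q J)
  show ?case
  proof (cases "\<forall>i\<in>I. a i q = 0")
    case True
    have "card J < card I" using insert by simp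
    from insert.IH[OF insert.prems(1) this, of a] True show ?thesis by auto
  next
    case False
    then obtain p where p: "p \<in> I" "a p q \<noteq> 0" by auto
    define b where "b = (\<lambda>i j. a i j - a i q / a p q * a p j)"
    have c: "card J < card (I - {p})" "finite (I - {p})" using insert p by auto
    from insert.IH[OF c(2,1), of b] obtain l where
      l: "\<exists>i\<in>I - {p}. l i \<noteq> 0" "\<And>j. j \<in> J \<Longrightarrow> (\<Sum>i\<in>I-{p}. l i * b i j) = 0" by blast
    define m where "m = l(p := - (\<Sum>i\<in>I-{p}. l i * (a i q / a p q)))"
    have S: "(\<Sum>i\<in>I. m i * a i j) = (\<Sum>i\<in>I-{p}. l i * b i j)" for j
    proof -
      have "(\<Sum>i\<in>I. m i * a i j) = m p * a p j + (\<Sum>i\<in>I-{p}. m i * a i j)"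
        using insert.prems p by (simp add: sum.remove)
      also have "(\<Sum>i\<in>I-{p}. m i * a i j) = (\<Sum>i\<in>I-{p}. l i * a i j)"
        by (rule sum.cong) (auto simp: m_def)
      moreover have "m p = - (\<Sum>i\<in>I-{p}. l i * (a i q / a p q))" by (simp add: m_def)
      ultimately show ?thesis
        by (simp add: b_def sum_distrib_left sum_distrib_right sum_subtractf right_diff_distrib mult_ac)
    qed
    have "b i q = 0" for i using p by (simp add: b_def)
    then have "(\<Sum>i\<in>I. m i * a i j) = 0" if "j \<in> insert q J" for j
      using that l by (auto simp: S)
    moreover have "\<exists>i\<in>I. m i \<noteq> 0" using l by (auto simp: m_def)
    ultimately show ?thesis by blast
  qed
qed

section \<open>Prime ideals avoiding a multiplicative set\<close>

definition is_ideal :: "'a::comm_ring_1 set \<Rightarrow> bool" where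
  "is_ideal I \<longleftrightarrow> 0 \<in> I \<and> (\<forall>a\<in>I. \<forall>b\<in>I. a + b \<in> I) \<and> (\<forall>a\<in>I. \<forall>r. r * a \<in> I)"

definition is_prime_ideal :: "'a::comm_ring_1 set \<Rightarrow> bool" where
  "is_prime_ideal P \<longleftrightarrow> is_ideal P \<and> 1 \<notin> P \<and> (\<forall>a b. a * b \<in> P \<longrightarrow> a \<in> P \<or> b \<in> P)"

definition adjoin :: "'a::comm_ring_1 set \<Rightarrow> 'a \<Rightarrow> 'a set" where
  "adjoin I a = {p + r * a | p r. p \<in> I}"

lemma is_ideal_adjoin:
  assumes "is_ideal I"
  shows "is_ideal (adjoin I a)"
  unfolding is_ideal_def
proof (intro conjI ballI allI)
  have "0 = 0 + 0 * a" by simp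
  then show "0 \<in> adjoin I a" using assms unfolding adjoin_def is_ideal_def by blast
next
  fix x y assume "x \<in> adjoin I a" "y \<in> adjoin I a"
  then obtain p r q s where "p \<in> I" "x = p + r * a" "q \<in> I" "y = q + s * a"
    by (auto simp: adjoin_def)
  moreover from this have "x + y = (p + q) + (r + s) * a" by (simp add: algebra_simps)
  ultimately show "x + y \<in> adjoin I a" using assms unfolding adjoin_def is_ideal_def by blast
next
  fix x t assume "x \<in> adjoin I a"
  then obtain p r where "p \<in> I" "x = p + r * a" by (auto simp: adjoin_def)
  moreover from this have "t * x = t * p + (t * r) * a" by (simp add: algebra_simps)
  ultimately show "t * x \<in> adjoin I a" using assms unfolding adjoin_def is_ideal_def by blast
qed

lemma adjoin_superset: "I \<subseteq> adjoin I a"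
proof
  fix p assume "p \<in> I"
  moreover have "p = p + 0 * a" by simp
  ultimately show "p \<in> adjoin I a" unfolding adjoin_def by blast
qed

lemma adjoin_member: "is_ideal I \<Longrightarrow> a \<in> adjoin I a"
  unfolding adjoin_def is_ideal_def by (rule CollectI, rule exI[of _ 0], rule exI[of _ 1]) simp

lemma is_ideal_sum: "is_ideal I \<Longrightarrow> (\<And>x. x \<in> A \<Longrightarrow> f x \<in> I) \<Longrightarrow> sum f A \<in> I"
  by (induction A rule: infinite_finite_induct) (auto simp: is_ideal_def)

text \<open>An ideal that is maximal among those that avoid \<open>S\<close> is prime: if neither \<open>a\<close> nor \<open>b\<close> lies in
  it, then adjoining either one produces an element of \<open>S\<close>, and the product of these two elements lies in
  the ideal as soon as \<open>a * b\<close> does.\<close>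

lemma exists_prime_ideal_avoiding:
  fixes I S :: "'a::comm_ring_1 set"
  assumes I: "is_ideal I" "I \<inter> S = {}" and S: "1 \<in> S" "\<And>a b. a \<in> S \<Longrightarrow> b \<in> S \<Longrightarrow> a * b \<in> S"
  obtains P where "is_prime_ideal P" "I \<subseteq> P" "P \<inter> S = {}"
proof -
  let ?A = "{P. is_ideal P \<and> I \<subseteq> P \<and> P \<inter> S = {}}"
  have "\<exists>M\<in>?A. \<forall>X\<in>?A. M \<subseteq> X \<longrightarrow> X = M"
  proof (rule subset_Zorn_nonempty)
    show "?A \<noteq> {}" using I by auto
  next
    fix C assume C: "C \<noteq> {}" "subset.chain ?A C"
    have id: "is_ideal X" "I \<subseteq> X" "X \<inter> S = {}" if "X \<in> C" for X
      using C that by (auto simp: subset.chain_def)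
    have "is_ideal (\<Union>C)"
      unfolding is_ideal_def
    proof (intro conjI ballI allI)
      show "0 \<in> \<Union>C" using C id by (auto simp: is_ideal_def)
    next
      fix a b assume "a \<in> \<Union>C" "b \<in> \<Union>C"
      then obtain X Y where XY: "X \<in> C" "Y \<in> C" "a \<in> X" "b \<in> Y" by auto
      then have "X \<subseteq> Y \<or> Y \<subseteq> X" using C unfolding subset.chain_def by blast
      then show "a + b \<in> \<Union>C" using XY id(1)[of X] id(1)[of Y] unfolding is_ideal_def by blast
    next
      fix a r assume "a \<in> \<Union>C"
      then show "r * a \<in> \<Union>C" using id(1) unfolding is_ideal_def by blast
    qed
    moreover have "I \<subseteq> \<Union>C" using C(1) id(2) by blast
    moreover have "\<Union>C \<inter> S = {}" using id(3) by blast
    ultimately show "\<Union>C \<in> ?A" by blast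
  qed
  then obtain P where P: "is_ideal P" "I \<subseteq> P" "P \<inter> S = {}"
    and max: "\<And>X. is_ideal X \<Longrightarrow> P \<subseteq> X \<Longrightarrow> X \<inter> S = {} \<Longrightarrow> X = P" by auto
  have hit: "\<exists>p r. p \<in> P \<and> p + r * a \<in> S" if "a \<notin> P" for a
  proof -
    have "adjoin P a \<inter> S \<noteq> {}"
      using max[OF is_ideal_adjoin[OF P(1)] adjoin_superset] adjoin_member[OF P(1), of a] that by metis
    then show ?thesis by (auto simp: adjoin_def)
  qed
  have "a \<in> P \<or> b \<in> P" if ab: "a * b \<in> P" for a b
  proof (rule ccontr)
    assume "\<not> (a \<in> P \<or> b \<in> P)"
    then obtain p r q s where *: "p \<in> P" "p + r * a \<in> S" "q \<in> P" "q + s * b \<in> S"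
      using hit by meson
    have "(p + r * a) * (q + s * b) = (q + s * b) * p + (r * a) * q + (r * s) * (a * b)"
      by (simp add: algebra_simps)
    also have "\<dots> \<in> P" using P(1) * ab unfolding is_ideal_def by blast
    finally show False using S(2)[OF *(2,4)] P(3) by auto
  qed
  then have "is_prime_ideal P" using P S(1) unfolding is_prime_ideal_def by auto
  then show ?thesis using P(2,3) by (rule that)
qed

section \<open>A lower bound for the Krull dimension\<close>

definition depends_only_on :: "'v set \<Rightarrow> ('k ^ 'v \<Rightarrow> 'k) \<Rightarrow> bool" where
  "depends_only_on T f \<longleftrightarrow> (\<forall>x y. (\<forall>i\<in>T. x $ i = y $ i) \<longrightarrow> f x = f y)"

text \<open>Membership only concerns the function that a polynomial defines. Over an infinite field these are the
  nonzero elements of \<open>k[x\<^sub>i | i \<in> T]\<close>, and with this formulation no formal comparison of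
  coefficients is needed to see that a product of two of them is again one.\<close>

definition nonzero_polys :: "'v::finite set \<Rightarrow> ('v, 'k::comm_ring_1) mpoly set" where
  "nonzero_polys T = {p. depends_only_on T (mpoly_eval p) \<and> (\<exists>x. mpoly_eval p x \<noteq> 0)}"

lemma one_in_nonzero_polys: "1 \<in> nonzero_polys T"
  by (auto simp: nonzero_polys_def depends_only_on_def)

text \<open>Algebraic independence of the coordinates in \<open>T\<close> on a set says that its vanishing ideal avoids
  \<open>nonzero_polys T\<close>. Since this set is multiplicatively closed, it can be avoided by prime ideals.\<close>

lemma mult_in_nonzero_polys:
  fixes p q :: "('v::finite, 'k::field_char_0) mpoly"
  assumes "p \<in> nonzero_polys T" "q \<in> nonzero_polys T"
  shows "p * q \<in> nonzero_polys T"
proof -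
  obtain x y where "mpoly_eval p x \<noteq> 0" "mpoly_eval q y \<noteq> 0"
    using assms by (auto simp: nonzero_polys_def)
  from is_poly_no_zero_divisors[OF is_poly_mpoly_eval is_poly_mpoly_eval this]
  have "\<exists>x. mpoly_eval (p * q) x \<noteq> 0" by (simp add: mpoly_eval_mult)
  moreover have "depends_only_on T (mpoly_eval (p * q))"
    using assms unfolding nonzero_polys_def depends_only_on_def mem_Collect_eq mpoly_eval_mult by metis
  ultimately show ?thesis by (simp add: nonzero_polys_def)
qed

lemma uncountable_UNIV_real_normed_field: "uncountable (UNIV :: 'k::real_normed_field set)"
proof
  assume "countable (UNIV :: 'k set)"
  then have "countable (range (of_real :: real \<Rightarrow> 'k))" by (rule countable_subset[rotated]) simp
  then have "countable (UNIV :: real set)"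
    by (rule countable_image_inj_on) (simp add: inj_on_def)
  then show False using uncountable_UNIV_real by blast
qed

lemma countable_exponents: "countable (UNIV :: ('v::finite \<Rightarrow>\<^sub>0 nat) set)"
proof -
  have "countable (range (Poly_Mapping.lookup :: ('v \<Rightarrow>\<^sub>0 nat) \<Rightarrow> 'v \<Rightarrow> nat))"
    by (rule countable_subset[OF subset_UNIV]) simp
  then show ?thesis
    by (rule countable_image_inj_on) (auto intro!: injI poly_mapping_eqI)
qed

lemma lookup_mConst_mult: "Poly_Mapping.lookup (mConst c * p) m = c * Poly_Mapping.lookup p m"
  unfolding mult_map_scale_conv_mult[symmetric] Poly_Mapping.map.rep_eq by (simp add: when_def)

text \<open>There are only countably many finite sets of exponents but uncountably many indices, so infinitely many members
  of the family are supported on the same finite set of monomials, and finitely many of those are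
  linearly dependent. The field cannot be replaced by a countable one here.\<close>

lemma exists_linear_relation_in_family:
  fixes g :: "'k::real_normed_field \<Rightarrow> ('v::finite, 'k) mpoly"
  obtains B b0 l where "finite B" "b0 \<in> B" "l b0 \<noteq> 0" "(\<Sum>b\<in>B. mConst (l b) * g b) = 0"
proof -
  let ?K = "\<lambda>a. Poly_Mapping.keys (g a)"
  have "\<exists>Y. infinite {a. ?K a = Y}"
  proof (rule ccontr)
    assume "\<not> ?thesis"
    then have fin: "finite {a. ?K a = Y}" for Y by auto
    have "countable (range ?K)"
      by (rule countable_subset[OF image_subsetI countable_Collect_finite_subset[OF countable_exponents]])
         simp
    then have "countable (\<Union>Y\<in>range ?K. {a. ?K a = Y})"
      by (rule countable_UN) (rule countable_finite, rule fin)
    moreover have "(\<Union>Y\<in>range ?K. {a. ?K a = Y}) = UNIV" by auto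
    ultimately have "countable (UNIV :: 'k set)" by (simp only:)
    then show False using uncountable_UNIV_real_normed_field by contradiction
  qed
  then obtain Y where Y: "infinite {a. ?K a = Y}" by blast
  then obtain a0 where "?K a0 = Y" using infinite_imp_nonempty by blast
  then have "finite Y" using finite_keys[of "g a0"] by simp
  obtain B where B: "finite B" "card B = Suc (card Y)" "B \<subseteq> {a. ?K a = Y}"
    using infinite_arbitrarily_large[OF Y] by blast
  obtain l where l: "\<exists>i\<in>B. l i \<noteq> 0" "\<And>j. j \<in> Y \<Longrightarrow> (\<Sum>i\<in>B. l i * Poly_Mapping.lookup (g i) j) = 0"
    using nontrivial_solution_of_homogeneous_system[OF \<open>finite Y\<close> B(1), of "\<lambda>i. Poly_Mapping.lookup (g i)"] B(2)
    by auto
  have sum: "(\<Sum>b\<in>B. mConst (l b) * g b) = 0"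
  proof (rule poly_mapping_eqI)
    fix m
    show "Poly_Mapping.lookup (\<Sum>b\<in>B. mConst (l b) * g b) m = Poly_Mapping.lookup 0 m"
    proof (cases "m \<in> Y")
      case True
      then show ?thesis by (simp add: lookup_sum lookup_mConst_mult l(2))
    next
      case False
      then have "Poly_Mapping.lookup (g b) m = 0" if "b \<in> B" for b
        using B(3) that by (auto simp: in_keys_iff)
      then show ?thesis by (simp add: lookup_sum lookup_mConst_mult)
    qed
  qed
  obtain b0 where "b0 \<in> B" "l b0 \<noteq> 0" using l(1) by blast
  from that[of B b0 l, OF B(1) this sum] show ?thesis .
qed

text \<open>This is the step from transcendence degree \<open>s\<close> to \<open>s - 1\<close>, with Amitsur's counting argument in
  place of Zariski's lemma. If every hyperplane \<open>x\<^sub>v = a\<close> failed, then modulo \<open>P\<close> every \<open>x\<^sub>v - a\<close>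
  would have an inverse \<open>g\<^sub>a / c\<^sub>a\<close> whose denominator \<open>c\<^sub>a\<close> only involves the other coordinates in \<open>T\<close>. Some
  of the uncountably many \<open>g\<^sub>a\<close> satisfy a linear relation over the field. Clearing denominators
  turns it into a relation between the coordinates in \<open>T\<close>, and evaluation at \<open>x\<^sub>v = b\<close> shows that this
  relation is nontrivial.\<close>

lemma exists_hyperplane_section_avoiding:
  fixes P :: "('v::finite, 'k::real_normed_field) mpoly set"
  assumes P: "is_ideal P" "P \<inter> nonzero_polys T = {}" and v: "v \<in> T"
  shows "\<exists>a. adjoin P (mVar v - mConst a) \<inter> nonzero_polys (T - {v}) = {}"
proof (rule ccontr)
  assume "\<not> ?thesis"
  then have "\<forall>a. \<exists>p g. p \<in> P \<and> p + g * (mVar v - mConst a) \<in> nonzero_polys (T - {v})"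
    unfolding adjoin_def by blast
  then obtain p g where pg: "\<And>a. p a \<in> P"
      "\<And>a. p a + g a * (mVar v - mConst a) \<in> nonzero_polys (T - {v})"
    by metis
  define c where "c = (\<lambda>a. p a + g a * (mVar v - mConst a))"
  obtain B b0 l where B: "finite B" "b0 \<in> B" "l b0 \<noteq> 0" "(\<Sum>b\<in>B. mConst (l b) * g b) = 0"
    by (rule exists_linear_relation_in_family[of g])
  define D where "D = (\<lambda>b. \<Prod>b'\<in>B-{b}. mVar v - mConst b' :: ('v, 'k) mpoly)"
  define w where "w = (\<Sum>b\<in>B. mConst (l b) * c b * D b)"
  \<comment> \<open>The terms with \<open>g\<close> share the factor \<open>\<Prod>b\<in>B. x\<^sub>v - b\<close> and cancel by the linear relation, so \<open>w\<close> lies in \<open>P\<close>.\<close>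
  have "w = (\<Sum>b\<in>B. mConst (l b) * D b * p b + (mVar v - mConst b) * D b * (mConst (l b) * g b))"
    unfolding w_def c_def by (rule sum.cong) (simp_all add: algebra_simps)
  also have "\<dots> = (\<Sum>b\<in>B. mConst (l b) * D b * p b) +
      (\<Sum>b\<in>B. (\<Prod>b'\<in>B. mVar v - mConst b') * (mConst (l b) * g b))"
    unfolding sum.distrib[symmetric] D_def
    by (rule sum.cong) (simp_all add: prod.remove[OF B(1)])
  also have "\<dots> = (\<Sum>b\<in>B. mConst (l b) * D b * p b)"
    by (simp flip: sum_distrib_left add: B(4))
  also have "\<dots> \<in> P"
    using P(1) pg(1) by (intro is_ideal_sum) (auto simp: is_ideal_def)
  finally have "w \<in> P" .
  have ev: "mpoly_eval w x = (\<Sum>b\<in>B. l b * mpoly_eval (c b) x * (\<Prod>b'\<in>B-{b}. x $ v - b'))" for x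
    by (simp add: w_def D_def mpoly_eval_sum mpoly_eval_mult mpoly_eval_prod mpoly_eval_diff)
  have cdep: "mpoly_eval (c b) x = mpoly_eval (c b) y" if "\<And>i. i \<in> T \<Longrightarrow> i \<noteq> v \<Longrightarrow> x $ i = y $ i" for b x y
    using pg(2)[of b] that unfolding c_def nonzero_polys_def depends_only_on_def by blast
  have "depends_only_on T (mpoly_eval w)"
    unfolding depends_only_on_def ev
  proof (intro allI impI sum.cong refl)
    fix x y :: "'k ^ 'v" and b assume "\<forall>i\<in>T. x $ i = y $ i"
    then show "l b * mpoly_eval (c b) x * (\<Prod>b'\<in>B - {b}. x $ v - b') =
               l b * mpoly_eval (c b) y * (\<Prod>b'\<in>B - {b}. y $ v - b')"
      using cdep[of x y b] v by auto
  qed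
  moreover have "\<exists>x. mpoly_eval w x \<noteq> 0"
  proof -
    obtain x where x: "mpoly_eval (c b0) x \<noteq> 0" using pg(2)[of b0] by (auto simp: c_def nonzero_polys_def)
    \<comment> \<open>Moving to \<open>x\<^sub>v = b0\<close> does not change \<open>c b0\<close> and kills every summand except the one of \<open>b0\<close>.\<close>
    define y where "y = (\<chi> i. if i = v then b0 else x $ i)"
    have "mpoly_eval w y = (\<Sum>b\<in>{b0}. l b * mpoly_eval (c b) y * (\<Prod>b'\<in>B-{b}. y $ v - b'))"
      unfolding ev
    proof (rule sum.mono_neutral_right)
      show "\<forall>b\<in>B - {b0}. l b * mpoly_eval (c b) y * (\<Prod>b'\<in>B - {b}. y $ v - b') = 0"
        using B by (auto simp: y_def)
    qed (use B in auto)
    also have "\<dots> \<noteq> 0"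
      using B x cdep[of x y b0] by (auto simp: y_def)
    finally show ?thesis by blast
  qed
  ultimately have "w \<in> nonzero_polys T" by (simp add: nonzero_polys_def)
  then show False using P(2) \<open>w \<in> P\<close> by blast
qed

text \<open>Each hyperplane section costs one independent coordinate and makes the prime ideal strictly larger:
  \<open>x\<^sub>v - a\<close> is itself a nonzero polynomial in the coordinates of \<open>T\<close>, so it does not lie in the
  previous prime.\<close>

lemma exists_chain_of_prime_ideals:
  fixes I :: "('v::finite, 'k::real_normed_field) mpoly set"
  assumes "is_ideal I" "I \<inter> nonzero_polys T = {}"
  shows "\<exists>P. (\<forall>i\<le>card T. is_prime_ideal (P i)) \<and> I \<subseteq> P 0 \<and> (\<forall>i<card T. P i \<subset> P (Suc i))"
  using assms
proof (induction "card T" arbitrary: T I)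
  case 0
  obtain Q where "is_prime_ideal Q" "I \<subseteq> Q"
    by (rule exists_prime_ideal_avoiding[OF "0.prems" one_in_nonzero_polys mult_in_nonzero_polys])
  then show ?case using "0.hyps" by (intro exI[of _ "\<lambda>_. Q"]) auto
next
  case (Suc n)
  obtain Q where Q: "is_prime_ideal Q" "I \<subseteq> Q" "Q \<inter> nonzero_polys T = {}"
    by (rule exists_prime_ideal_avoiding[OF Suc.prems one_in_nonzero_polys mult_in_nonzero_polys])
  then have "is_ideal Q" by (simp add: is_prime_ideal_def)
  obtain v where v: "v \<in> T" using Suc.hyps(2) by fastforce
  obtain a where a: "adjoin Q (mVar v - mConst a) \<inter> nonzero_polys (T - {v}) = {}"
    using exists_hyperplane_section_avoiding[OF \<open>is_ideal Q\<close> Q(3) v] by blast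
  have n: "n = card (T - {v})" using Suc.hyps(2) v by simp
  obtain P where P: "\<And>i. i \<le> n \<Longrightarrow> is_prime_ideal (P i)" "adjoin Q (mVar v - mConst a) \<subseteq> P 0"
      "\<And>i. i < n \<Longrightarrow> P i \<subset> P (Suc i)"
    using Suc.hyps(1)[OF n is_ideal_adjoin[OF \<open>is_ideal Q\<close>] a] unfolding n by blast
  have "mpoly_eval (mVar v - mConst a) (\<chi> i. a + 1) \<noteq> 0" by (simp add: mpoly_eval_diff)
  moreover have "depends_only_on T (mpoly_eval (mVar v - mConst a))"
    using v by (auto simp: depends_only_on_def mpoly_eval_diff)
  ultimately have "mVar v - mConst a \<in> nonzero_polys T"
    unfolding nonzero_polys_def by blast
  then have "Q \<subset> P 0"
    using P(2) adjoin_superset[of Q] adjoin_member[OF \<open>is_ideal Q\<close>] Q(3) by blast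
  then have "case_nat Q P i \<subset> case_nat Q P (Suc i)" if "i < Suc n" for i
    using that P(3) by (cases i) auto
  moreover have "is_prime_ideal (case_nat Q P i)" if "i \<le> Suc n" for i
    using that P(1) Q(1) by (cases i) auto
  moreover have "I \<subseteq> case_nat Q P 0" using Q(2) by simp
  ultimately show ?case
    unfolding Suc.hyps(2)[symmetric] by (intro exI[of _ "case_nat Q P"]) blast
qed

lemma cring_mpoly_ring: "cring (mpoly_ring :: ('v, 'k::comm_ring_1) mpoly ring)"
proof (rule cringI)
  show "abelian_group (mpoly_ring :: ('v, 'k) mpoly ring)"
  proof (rule abelian_groupI)
    fix x :: "('v, 'k) mpoly"
    show "\<exists>y\<in>carrier mpoly_ring. y \<oplus>\<^bsub>mpoly_ring\<^esub> x = \<zero>\<^bsub>mpoly_ring\<^esub>"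
      by (rule bexI[of _ "- x"]) (simp_all add: mpoly_ring_def)
  qed (simp_all add: mpoly_ring_def add_ac)
  show "comm_monoid (mpoly_ring :: ('v, 'k) mpoly ring)"
    by (rule comm_monoidI) (simp_all add: mpoly_ring_def mult_ac)
qed (simp_all add: mpoly_ring_def distrib_right)

lemma ideal_mpoly_ring:
  assumes "is_ideal I"
  shows "ideal I (mpoly_ring :: ('v, 'k::comm_ring_1) mpoly ring)"
proof -
  interpret cring "mpoly_ring :: ('v, 'k) mpoly ring" by (rule cring_mpoly_ring)
  have neg: "\<ominus>\<^bsub>mpoly_ring\<^esub> a = - a" for a :: "('v, 'k) mpoly"
    by (rule minus_equality) (auto simp: mpoly_ring_def)
  have "- a \<in> I" if "a \<in> I" for a
    using assms that unfolding is_ideal_def by (metis mult_minus1)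
  then have neg_mem: "\<ominus>\<^bsub>mpoly_ring\<^esub> a \<in> I" if "a \<in> I" for a using that neg by simp
  show ?thesis
  proof (rule idealI[OF ring_axioms])
    show "subgroup I (add_monoid mpoly_ring)"
    proof (rule add.subgroupI)
      show "I \<noteq> {}" using assms by (auto simp: is_ideal_def)
    next
      fix a b assume "a \<in> I" "b \<in> I"
      then show "a \<oplus>\<^bsub>mpoly_ring\<^esub> b \<in> I" using assms by (simp add: is_ideal_def mpoly_ring_def)
    qed (use neg_mem in \<open>auto simp: mpoly_ring_def\<close>)
  next
    fix a x assume "a \<in> I"
    then have "x * a \<in> I" using assms by (simp add: is_ideal_def)
    then show "x \<otimes>\<^bsub>mpoly_ring\<^esub> a \<in> I" "a \<otimes>\<^bsub>mpoly_ring\<^esub> x \<in> I"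
      by (simp_all add: mpoly_ring_def mult.commute)
  qed
qed

text \<open>All primes of the chain contain \<open>I\<close>, so they are determined by their images in the quotient and the
  inclusions between the images stay strict.\<close>

lemma card_le_krull_dim_quotient:
  fixes I :: "('v::finite, 'k::real_normed_field) mpoly set"
  assumes I: "is_ideal I" "I \<inter> nonzero_polys T = {}"
  shows "enat (card T) \<le> krull_dim (mpoly_ring Quot I)"
proof -
  let ?R = "mpoly_ring :: ('v, 'k) mpoly ring"
  interpret cring ?R by (rule cring_mpoly_ring)
  interpret I: ideal I ?R using I by (intro ideal_mpoly_ring)
  have R: "carrier ?R = UNIV" "mult ?R = (*)" "add ?R = (+)" by (auto simp: mpoly_ring_def)
  define \<pi> where "\<pi> = (\<lambda>a. I +>\<^bsub>?R\<^esub> a)"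
  have \<pi>: "\<pi> a = (\<lambda>h. h + a) ` I" for a
    by (auto simp: \<pi>_def a_r_coset_def r_coset_def R)
  obtain P where P: "\<And>i. i \<le> card T \<Longrightarrow> is_prime_ideal (P i)" "I \<subseteq> P 0"
      "\<And>i. i < card T \<Longrightarrow> P i \<subset> P (Suc i)"
    using exists_chain_of_prime_ideals[OF I] by blast
  have IP: "I \<subseteq> P i" if "i \<le> card T" for i
    using that P(2,3) by (induction i) (auto, meson Suc_le_lessD order_less_imp_le psubsetD subsetD)
  have mem: "a \<in> P i" if i: "i \<le> card T" and a: "\<pi> a \<in> \<pi> ` P i" for a i
  proof -
    obtain b where b: "b \<in> P i" "\<pi> a = \<pi> b" using a by blast
    have "0 \<in> I" using I by (simp add: is_ideal_def)
    then have "a \<in> \<pi> b" using b(2) unfolding \<pi> by (metis add_0 image_eqI)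
    then obtain h where "h \<in> I" "a = h + b" by (auto simp: \<pi>)
    then show ?thesis using IP[OF i] P(1)[OF i] b(1)
      by (auto simp: is_prime_ideal_def is_ideal_def)
  qed
  have "primeideal (\<pi> ` P i) (?R Quot I)" if i: "i \<le> card T" for i
  proof (rule primeidealI)
    have "is_ideal (P i)" using P(1)[OF i] by (simp add: is_prime_ideal_def)
    then show "ideal (\<pi> ` P i) (?R Quot I)"
      unfolding \<pi>_def
      using ring_ideal_imp_quot_ideal[OF I.is_ideal ideal_mpoly_ring] by blast
    show "cring (?R Quot I)" by (rule I.quotient_is_cring) (rule cring_mpoly_ring)
    have "1 \<notin> P i" using P(1)[OF i] by (simp add: is_prime_ideal_def)
    then have "\<pi> 1 \<notin> \<pi> ` P i" using mem[OF i] by blast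
    moreover have carrier: "carrier (?R Quot I) = range \<pi>"
      by (auto simp: FactRing_def A_RCOSETS_def RCOSETS_def \<pi>_def a_r_coset_def R)
    ultimately show "carrier (?R Quot I) \<noteq> \<pi> ` P i" by blast
    fix x y
    assume "x \<in> carrier (?R Quot I)" "y \<in> carrier (?R Quot I)" and xy: "x \<otimes>\<^bsub>?R Quot I\<^esub> y \<in> \<pi> ` P i"
    then obtain a b where ab: "x = \<pi> a" "y = \<pi> b" by (auto simp: carrier)
    have "\<pi> a \<otimes>\<^bsub>?R Quot I\<^esub> \<pi> b = \<pi> (a * b)"
      unfolding \<pi>_def using I.rcoset_mult_add[of a b] by (simp add: FactRing_def R)
    with xy have "\<pi> (a * b) \<in> \<pi> ` P i" unfolding ab by (simp only:)
    then have "a * b \<in> P i" by (rule mem[OF i])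
    then have "a \<in> P i \<or> b \<in> P i" using P(1)[OF i] by (auto simp: is_prime_ideal_def)
    then show "x \<in> \<pi> ` P i \<or> y \<in> \<pi> ` P i" using ab by auto
  qed
  moreover have "\<pi> ` P i \<subset> \<pi> ` P (Suc i)" if i: "i < card T" for i
  proof -
    obtain a where "a \<in> P (Suc i)" "a \<notin> P i" using P(3)[OF i] by blast
    then have "\<pi> a \<in> \<pi> ` P (Suc i)" "\<pi> a \<notin> \<pi> ` P i" using mem[of i a] i by auto
    moreover have "\<pi> ` P i \<subseteq> \<pi> ` P (Suc i)" using P(3)[OF i] by (intro image_mono) blast
    ultimately show ?thesis by blast
  qed
  ultimately show ?thesis
    unfolding krull_dim_def by (intro Sup_upper CollectI exI[of _ "card T"] conjI refl
      exI[of _ "\<lambda>i. \<pi> ` P i"]) auto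
qed

lemma vanishing_ideal_zariski_closure: "vanishing_ideal (zariski_closure V) = vanishing_ideal V"
proof (intro equalityI subsetI)
  fix p assume p: "p \<in> vanishing_ideal (zariski_closure V)"
  have "V \<subseteq> zariski_closure V" by (auto simp: zariski_closure_def)
  then show "p \<in> vanishing_ideal V" using p by (auto simp: vanishing_ideal_def)
next
  fix p assume p: "p \<in> vanishing_ideal V"
  have "algebraic_set {x. mpoly_eval p x = 0}"
    unfolding algebraic_set_def by (rule exI[of _ "{p}"]) simp
  moreover have "V \<subseteq> {x. mpoly_eval p x = 0}" using p by (auto simp: vanishing_ideal_def)
  ultimately have "zariski_closure V \<subseteq> {x. mpoly_eval p x = 0}"
    unfolding zariski_closure_def by blast
  then show "p \<in> vanishing_ideal (zariski_closure V)" by (auto simp: vanishing_ideal_def)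
qed

lemma is_ideal_vanishing_ideal: "is_ideal (vanishing_ideal V)"
  by (auto simp: is_ideal_def vanishing_ideal_def mpoly_eval_add mpoly_eval_mult)

lemma card_le_alg_dim:
  fixes V :: "('k::real_normed_field ^ 'v::finite) set"
  assumes "vanishing_ideal V \<inter> nonzero_polys T = {}"
  shows "enat (card T) \<le> alg_dim V"
  unfolding alg_dim_def coordinate_ring_def vanishing_ideal_zariski_closure
  using card_le_krull_dim_quotient[OF is_ideal_vanishing_ideal assms] .

section \<open>Linear combinations of functions and monomials\<close>

definition lincomb_on :: "'a set \<Rightarrow> ('a \<Rightarrow> 'k::comm_ring_1) set \<Rightarrow> ('a \<Rightarrow> 'k) \<Rightarrow> bool" where
  "lincomb_on X H f \<longleftrightarrow> (\<exists>a. \<forall>x\<in>X. f x = (\<Sum>h\<in>H. a h * h x))"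

lemma lincomb_on_cong: "(\<And>x. x \<in> X \<Longrightarrow> f x = g x) \<Longrightarrow> lincomb_on X H f \<Longrightarrow> lincomb_on X H g"
  unfolding lincomb_on_def by simp

lemma lincomb_on_base: "finite H \<Longrightarrow> h \<in> H \<Longrightarrow> lincomb_on X H h"
  unfolding lincomb_on_def
  by (rule exI[of _ "\<lambda>g. if g = h then 1 else 0"]) (simp add: if_distrib[of "\<lambda>x. x * _"] cong: if_cong)

lemma lincomb_on_zero: "lincomb_on X H (\<lambda>x. 0)"
  unfolding lincomb_on_def by (rule exI[of _ "\<lambda>_. 0"]) simp

lemma lincomb_on_add:
  assumes "lincomb_on X H f" "lincomb_on X H g"
  shows "lincomb_on X H (\<lambda>x. f x + g x)"
proof -
  obtain a where "\<forall>x\<in>X. f x = (\<Sum>h\<in>H. a h * h x)"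
    using assms(1) unfolding lincomb_on_def by blast
  moreover obtain b where "\<forall>x\<in>X. g x = (\<Sum>h\<in>H. b h * h x)"
    using assms(2) unfolding lincomb_on_def by blast
  ultimately show ?thesis unfolding lincomb_on_def
    by (intro exI[of _ "\<lambda>h. a h + b h"]) (simp add: distrib_right sum.distrib)
qed

lemma lincomb_on_scale:
  assumes "lincomb_on X H f"
  shows "lincomb_on X H (\<lambda>x. c * f x)"
proof -
  obtain a where "\<forall>x\<in>X. f x = (\<Sum>h\<in>H. a h * h x)"
    using assms unfolding lincomb_on_def by blast
  then show ?thesis unfolding lincomb_on_def
    by (intro exI[of _ "\<lambda>h. c * a h"]) (simp add: sum_distrib_left mult_ac)
qed

lemma lincomb_on_sum:
  "(\<And>i. i \<in> I \<Longrightarrow> lincomb_on X H (f i)) \<Longrightarrow> lincomb_on X H (\<lambda>x. \<Sum>i\<in>I. f i x)"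
  by (induction I rule: infinite_finite_induct) (auto intro: lincomb_on_zero lincomb_on_add)

lemma lincomb_on_mult:
  assumes f: "lincomb_on X G f" and G: "\<And>g. g \<in> G \<Longrightarrow> lincomb_on X H (\<lambda>x. g x * k x)"
  shows "lincomb_on X H (\<lambda>x. f x * k x)"
proof -
  obtain a where a: "\<forall>x\<in>X. f x = (\<Sum>g\<in>G. a g * g x)"
    using f unfolding lincomb_on_def by blast
  have "lincomb_on X H (\<lambda>x. \<Sum>g\<in>G. a g * (g x * k x))"
    by (intro lincomb_on_sum lincomb_on_scale G)
  then show ?thesis
    by (rule lincomb_on_cong[rotated]) (simp add: a sum_distrib_right sum_distrib_left mult_ac)
qed

lemma lincomb_on_trans:
  assumes "lincomb_on X G f" "\<And>g. g \<in> G \<Longrightarrow> lincomb_on X H g"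
  shows "lincomb_on X H f"
  using lincomb_on_mult[of X G f H "\<lambda>_. 1"] assms by simp

lemma lincomb_on_mono:
  assumes "lincomb_on X G f" "G \<subseteq> H" "finite H"
  shows "lincomb_on X H f"
  using lincomb_on_trans[OF assms(1)] lincomb_on_base[OF assms(3)] assms(2) by blast

lemma lincomb_on_subset: "lincomb_on X H f \<Longrightarrow> Y \<subseteq> X \<Longrightarrow> lincomb_on Y H f"
  unfolding lincomb_on_def by blast

lemma lincomb_on_dependent:
  fixes f :: "'i \<Rightarrow> 'a \<Rightarrow> 'k::field"
  assumes "finite H" "finite I" "card H < card I" "\<And>i. i \<in> I \<Longrightarrow> lincomb_on X H (f i)"
  shows "\<exists>l. (\<exists>i\<in>I. l i \<noteq> 0) \<and> (\<forall>x\<in>X. (\<Sum>i\<in>I. l i * f i x) = 0)"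
proof -
  have "\<forall>i\<in>I. \<exists>a. \<forall>x\<in>X. f i x = (\<Sum>h\<in>H. a h * h x)"
    using assms(4) unfolding lincomb_on_def by blast
  from bchoice[OF this] obtain a where a: "\<forall>i\<in>I. \<forall>x\<in>X. f i x = (\<Sum>h\<in>H. a i h * h x)" by blast
  obtain l where l: "\<exists>i\<in>I. l i \<noteq> 0" "\<And>h. h \<in> H \<Longrightarrow> (\<Sum>i\<in>I. l i * a i h) = 0"
    using nontrivial_solution_of_homogeneous_system[OF assms(1-3), of a] by blast
  have "(\<Sum>i\<in>I. l i * f i x) = 0" if "x \<in> X" for x
  proof -
    have "(\<Sum>i\<in>I. l i * f i x) = (\<Sum>i\<in>I. \<Sum>h\<in>H. l i * a i h * h x)"
      using that by (intro sum.cong) (auto simp: a sum_distrib_left mult_ac)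
    also have "\<dots> = (\<Sum>h\<in>H. (\<Sum>i\<in>I. l i * a i h) * h x)"
      by (subst sum.swap) (simp add: sum_distrib_right)
    finally show ?thesis using l(2) by simp
  qed
  then show ?thesis using l(1) by blast
qed

definition monom_fun :: "('v::finite \<Rightarrow> nat) \<Rightarrow> 'k::comm_ring_1 ^ 'v \<Rightarrow> 'k" where
  "monom_fun e x = (\<Prod>i\<in>UNIV. (x $ i) ^ e i)"

definition exp_box :: "'v set \<Rightarrow> nat \<Rightarrow> ('v \<Rightarrow> nat) set" where
  "exp_box A K = {e. \<forall>i. if i \<in> A then e i \<le> K else e i = 0}"

lemma monom_fun_zero [simp]: "monom_fun (\<lambda>_. 0) x = 1"
  by (simp add: monom_fun_def)

lemma monom_fun_add: "monom_fun e x * monom_fun e' x = monom_fun (\<lambda>i. e i + e' i) x"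
  by (simp add: monom_fun_def power_add prod.distrib)

lemma monom_fun_upd: "monom_fun (e(i := k)) x = x $ i ^ k * monom_fun (e(i := 0)) x"
proof -
  have "monom_fun (e(i := k)) x = x $ i ^ k * (\<Prod>l\<in>UNIV-{i}. x $ l ^ e l)" for k
    unfolding monom_fun_def by (subst prod.remove[of _ i]) (auto intro!: prod.cong)
  from this[of k] this[of 0] show ?thesis by simp
qed

lemma monom_fun_Suc: "x $ i * monom_fun e x = monom_fun (e(i := Suc (e i))) x"
  using monom_fun_upd[of e i "Suc (e i)" x] monom_fun_upd[of e i "e i" x] by simp

lemma monom_fun_unit: "monom_fun ((\<lambda>_. 0)(i := 1)) x = x $ i"
  using monom_fun_Suc[of x i "\<lambda>_. 0"] by simp

lemma is_poly_monom_fun [is_poly_intros]: "is_poly (monom_fun e)"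
  unfolding monom_fun_def[abs_def] by (intro is_poly_intros)

lemma exp_box_eq_PiE: "exp_box (A :: 'v::finite set) K = PiE UNIV (\<lambda>i. if i \<in> A then {..K} else {0})"
  by (auto simp: exp_box_def PiE_def Pi_def split: if_splits)

lemma finite_exp_box [simp]: "finite (exp_box (A :: 'v::finite set) K)"
  unfolding exp_box_eq_PiE by (rule finite_PiE) auto

lemma card_exp_box: "card (exp_box (A :: 'v::finite set) K) = (K + 1) ^ card A"
proof -
  have "card (exp_box A K) = (\<Prod>i\<in>UNIV. if i \<in> A then K + 1 else 1)"
    unfolding exp_box_eq_PiE by (subst card_PiE) (auto intro!: prod.cong)
  also have "\<dots> = (\<Prod>i\<in>A. K + 1)"
    by (rule prod.mono_neutral_cong_right) auto
  finally show ?thesis by simp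
qed

lemma exp_box_mono: "K \<le> K' \<Longrightarrow> A \<subseteq> A' \<Longrightarrow> exp_box A K \<subseteq> exp_box A' K'"
  unfolding exp_box_def by (fastforce split: if_splits intro: le_trans)

lemma exp_box_add: "e \<in> exp_box A K \<Longrightarrow> e' \<in> exp_box A K' \<Longrightarrow> (\<lambda>i. e i + e' i) \<in> exp_box A (K + K')"
  unfolding exp_box_def by (auto simp: add_mono split: if_splits)

lemma exp_box_insert:
  assumes "a \<notin> A"
  shows "bij_betw (\<lambda>(k, e). e(a := k)) ({..K} \<times> exp_box A K) (exp_box (insert a A) K)"
proof (rule bij_betw_byWitness[where f' = "\<lambda>e. (e a, e(a := 0))"])
  show "\<forall>p\<in>{..K} \<times> exp_box A K. (\<lambda>e. (e a, e(a := 0))) ((\<lambda>(k, e). e(a := k)) p) = p"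
    using assms by (auto simp: exp_box_def fun_eq_iff split: if_splits)
  show "\<forall>e\<in>exp_box (insert a A) K. (\<lambda>(k, e). e(a := k)) (e a, e(a := 0)) = e" by auto
  show "(\<lambda>(k, e). e(a := k)) ` ({..K} \<times> exp_box A K) \<subseteq> exp_box (insert a A) K"
    by (auto simp: exp_box_def)
  show "(\<lambda>e. (e a, e(a := 0))) ` exp_box (insert a A) K \<subseteq> {..K} \<times> exp_box A K"
    using assms by (auto simp: exp_box_def split: if_splits)
qed

text \<open>The induction adds one variable at a time: for fixed values of the others, the sum is a polynomial in one
  variable that vanishes identically, so its coefficients vanish.\<close>

lemma monomials_independent:
  fixes l :: "('v::finite \<Rightarrow> nat) \<Rightarrow> 'k::real_normed_field"
  assumes "\<And>x. (\<Sum>e\<in>exp_box A K. l e * monom_fun e x) = 0" "e \<in> exp_box A K"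
  shows "l e = 0"
  using finite[of A] assms
proof (induction A arbitrary: l e rule: finite_induct)
  case empty
  have "exp_box {} K = {\<lambda>_::'v. 0}" by (auto simp: exp_box_def)
  then show ?case using empty by simp
next
  case (insert a A)
  have split: "(\<Sum>e\<in>exp_box (insert a A) K. l e * monom_fun e x)
      = (\<Sum>k\<le>K. (\<Sum>e\<in>exp_box A K. l (e(a := k)) * monom_fun e x) * (x $ a) ^ k)" for x
  proof -
    have "(\<Sum>e\<in>exp_box (insert a A) K. l e * monom_fun e x)
        = (\<Sum>(k, e)\<in>{..K} \<times> exp_box A K. l (e(a := k)) * monom_fun (e(a := k)) x)"
      by (subst sum.reindex_bij_betw[OF exp_box_insert[OF insert.hyps(2)], symmetric])
         (simp add: case_prod_unfold)
    also have "\<dots> = (\<Sum>(k, e)\<in>{..K} \<times> exp_box A K. l (e(a := k)) * monom_fun e x * (x $ a) ^ k)"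
    proof (rule sum.cong[OF refl], clarify)
      fix k e assume "e \<in> exp_box A K"
      then have "e(a := 0) = e" using insert.hyps(2) by (auto simp: exp_box_def fun_eq_iff split: if_splits)
      then show "l (e(a := k)) * monom_fun (e(a := k)) x = l (e(a := k)) * monom_fun e x * (x $ a) ^ k"
        using monom_fun_upd[of e a k x] by simp
    qed
    finally show ?thesis by (simp add: sum.cartesian_product[symmetric] sum_distrib_right)
  qed
  have coeff: "(\<Sum>e\<in>exp_box A K. l (e(a := k)) * monom_fun e x) = 0" if "k \<le> K" for k x
  proof -
    define y where "y = (\<lambda>t. \<chi> i. if i = a then t else x $ i)"
    have y: "monom_fun e (y t) = monom_fun e x" if "e \<in> exp_box A K" for e t
      unfolding monom_fun_def
      by (rule prod.cong) (use that insert.hyps(2) in \<open>auto simp: y_def exp_box_def split: if_splits\<close>)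
    have "(\<Sum>k\<le>K. (\<Sum>e\<in>exp_box A K. l (e(a := k)) * monom_fun e x) * t ^ k) = 0" for t
    proof -
      have "(\<Sum>k\<le>K. (\<Sum>e\<in>exp_box A K. l (e(a := k)) * monom_fun e x) * t ^ k)
          = (\<Sum>k\<le>K. (\<Sum>e\<in>exp_box A K. l (e(a := k)) * monom_fun e (y t)) * (y t $ a) ^ k)"
        by (intro sum.cong refl arg_cong2[where f = "(*)"]) (auto simp: y, auto simp: y_def)
      then show ?thesis using split[of "y t"] insert.prems(1) by simp
    qed
    then show ?thesis
      using polyfun_eq_0[of "\<lambda>k. \<Sum>e\<in>exp_box A K. l (e(a := k)) * monom_fun e x" K] that by blast
  qed
  have "(\<lambda>i. if i = a then 0 else e i) \<in> exp_box A K" "e a \<le> K"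
    using insert by (auto simp: exp_box_def split: if_splits)
  from insert.IH[of "\<lambda>e'. l (e'(a := e a))", OF coeff this(1)] this(2)
  have "l ((\<lambda>i. if i = a then 0 else e i)(a := e a)) = 0" by simp
  moreover have "(\<lambda>i. if i = a then 0 else e i)(a := e a) = e" by auto
  ultimately show ?case by simp
qed

section \<open>Growth of the space of polynomial functions\<close>

text \<open>The vanishing ideal of \<open>V\<close> is prime. In contrast to irreducibility in terms of closed subsets, this form passes
  directly to images and difference sets.\<close>

definition zariski_irreducible :: "('k::comm_ring_1 ^ 'n::finite) set \<Rightarrow> bool" where
  "zariski_irreducible V \<longleftrightarrow> V \<noteq> {} \<and>
     (\<forall>f g. is_poly f \<longrightarrow> is_poly g \<longrightarrow> (\<forall>x\<in>V. f x * g x = 0) \<longrightarrow> (\<forall>x\<in>V. f x = 0) \<or> (\<forall>x\<in>V. g x = 0))"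

text \<open>An upper bound of order \<open>d\<close> on the Hilbert function of \<open>Z\<close>, where degrees are bounded in each variable
  separately and only the order of growth in \<open>K\<close> counts.\<close>

definition growth_le :: "('k::comm_ring_1 ^ 'n::finite) set \<Rightarrow> nat \<Rightarrow> bool" where
  "growth_le Z d \<longleftrightarrow> (\<exists>C. \<forall>K. \<exists>H. finite H \<and> card H \<le> C * (K + 1) ^ d \<and>
     (\<forall>e\<in>exp_box UNIV K. lincomb_on Z H (monom_fun e)))"

text \<open>The two sets have the same Zariski closure when \<open>Z\<close> is a subset of \<open>V\<close>; the inclusion is kept separate
  because the arguments below only transfer identities from \<open>Z\<close> to \<open>V\<close>.\<close>

definition dense_in :: "('k::comm_ring_1 ^ 'n::finite) set \<Rightarrow> ('k ^ 'n) set \<Rightarrow> bool" where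
  "dense_in Z V \<longleftrightarrow> (\<forall>f. is_poly f \<longrightarrow> (\<forall>x\<in>Z. f x = 0) \<longrightarrow> (\<forall>x\<in>V. f x = 0))"

definition alg_indep :: "'n::finite set \<Rightarrow> ('k::comm_ring_1 ^ 'n) set \<Rightarrow> bool" where
  "alg_indep T V \<longleftrightarrow> vanishing_ideal V \<inter> nonzero_polys T = {}"

lemma alg_indepD:
  assumes "alg_indep T V" "is_poly f" "depends_only_on T f" "f x0 \<noteq> 0"
  shows "\<exists>x\<in>V. f x \<noteq> 0"
proof -
  obtain p where "\<forall>x. f x = mpoly_eval p x" using assms(2) by (auto simp: is_poly_def)
  then have p: "f = mpoly_eval p" by auto
  then have "p \<in> nonzero_polys T" using assms by (auto simp: nonzero_polys_def)
  then have "p \<notin> vanishing_ideal V" using assms(1) by (auto simp: alg_indep_def)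
  then show ?thesis by (auto simp: p vanishing_ideal_def)
qed

lemma zariski_irreducible_prod_nonzero:
  assumes "zariski_irreducible V" "finite A" "\<And>a. a \<in> A \<Longrightarrow> is_poly (f a) \<and> (\<exists>x\<in>V. f a x \<noteq> 0)"
  shows "\<exists>x\<in>V. (\<Prod>a\<in>A. f a x) \<noteq> 0"
  using assms(2,3)
proof (induction A rule: finite_induct)
  case empty
  then show ?case using assms(1) by (auto simp: zariski_irreducible_def)
next
  case (insert a A)
  have "is_poly (f a)" "is_poly (\<lambda>x. \<Prod>a\<in>A. f a x)"
    using insert.prems by (auto intro: is_poly_prod)
  moreover have "\<exists>x\<in>V. (\<Prod>a\<in>A. f a x) \<noteq> 0" "\<exists>x\<in>V. f a x \<noteq> 0" using insert by blast+
  ultimately have "\<exists>x\<in>V. f a x * (\<Prod>a\<in>A. f a x) \<noteq> 0"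
    using assms(1) unfolding zariski_irreducible_def by blast
  then show ?case using insert.hyps by simp
qed

lemma dense_in_nonvanishing:
  fixes V :: "('k::comm_ring_1 ^ 'n::finite) set"
  assumes "zariski_irreducible V" "is_poly c" "\<exists>x\<in>V. c x \<noteq> 0"
  shows "dense_in {x\<in>V. c x \<noteq> 0} V"
  unfolding dense_in_def
proof (intro allI impI)
  fix f :: "'k ^ 'n \<Rightarrow> 'k"
  assume "is_poly f" "\<forall>x\<in>{x\<in>V. c x \<noteq> 0}. f x = 0"
  then have "\<forall>x\<in>V. c x * f x = 0" by auto
  then show "\<forall>x\<in>V. f x = 0"
    using assms \<open>is_poly f\<close> unfolding zariski_irreducible_def by blast
qed

abbreviation poly_span :: "'n::finite set \<Rightarrow> nat \<Rightarrow> ('k::comm_ring_1 ^ 'n \<Rightarrow> 'k) \<Rightarrow> bool" where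
  "poly_span T E f \<equiv> lincomb_on UNIV (monom_fun ` exp_box T E) f"

lemma poly_span_mono: "poly_span T E f \<Longrightarrow> E \<le> E' \<Longrightarrow> poly_span T E' f"
  by (erule lincomb_on_mono) (auto dest: exp_box_mono[OF _ subset_refl])

lemma poly_span_is_poly: 
  assumes "poly_span T E f"
  shows "is_poly f"
proof -
  obtain a where "\<forall>x\<in>UNIV. f x = (\<Sum>h\<in>monom_fun ` exp_box T E. a h * h x)"
    using assms unfolding lincomb_on_def by blast
  then have "f = (\<lambda>x. \<Sum>h\<in>monom_fun ` exp_box T E. a h * h x)" by auto
  then show ?thesis by (auto intro!: is_poly_intros)
qed

lemma poly_span_depends_only_on:
  fixes f :: "'k::comm_ring_1 ^ 'n::finite \<Rightarrow> 'k"
  assumes "poly_span T E f"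
  shows "depends_only_on T f"
  unfolding depends_only_on_def
proof (intro allI impI)
  fix x y :: "'k ^ 'n" assume xy: "\<forall>i\<in>T. x $ i = y $ i"
  obtain a where a: "\<forall>x\<in>UNIV. f x = (\<Sum>h\<in>monom_fun ` exp_box T E. a h * h x)"
    using assms unfolding lincomb_on_def by blast
  have eq: "h x = h y" if h: "h \<in> monom_fun ` exp_box T E" for h :: "'k ^ 'n \<Rightarrow> 'k"
  proof -
    obtain e where e: "h = monom_fun e" "e \<in> exp_box T E" using h by blast
    have "x $ i ^ e i = y $ i ^ e i" for i
      using e(2) xy by (cases "i \<in> T") (auto simp: exp_box_def split: if_splits dest: spec[of _ i])
    then show ?thesis unfolding e(1) monom_fun_def by simp
  qed
  have "(\<Sum>h\<in>monom_fun ` exp_box T E. a h * h x) = (\<Sum>h\<in>monom_fun ` exp_box T E. a h * h y)"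
  proof (rule sum.cong[OF refl])
    fix h :: "'k ^ 'n \<Rightarrow> 'k" assume "h \<in> monom_fun ` exp_box T E"
    from eq[OF this] show "a h * h x = a h * h y" by simp
  qed
  then show "f x = f y" using a by simp
qed

lemma poly_span_mult:
  fixes f :: "'k::comm_ring_1 ^ 'n::finite \<Rightarrow> 'k"
  assumes "poly_span T E f" "poly_span T E' g"
  shows "poly_span T (E + E') (\<lambda>x. f x * g x)"
proof (rule lincomb_on_mult[OF assms(1)])
  fix m :: "'k ^ 'n \<Rightarrow> 'k" assume "m \<in> monom_fun ` exp_box T E"
  then obtain e where e: "m = monom_fun e" "e \<in> exp_box T E" by blast
  have "poly_span T (E + E') (\<lambda>x. g x * m x)"
  proof (rule lincomb_on_mult[OF assms(2)])
    fix m' :: "'k ^ 'n \<Rightarrow> 'k" assume "m' \<in> monom_fun ` exp_box T E'"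
    then obtain e' where e': "m' = monom_fun e'" "e' \<in> exp_box T E'" by blast
    have "(\<lambda>x. m' x * m x) = monom_fun (\<lambda>i. e i + e' i)"
      unfolding e e' by (simp add: monom_fun_add[symmetric] mult.commute fun_eq_iff)
    then show "poly_span T (E + E') (\<lambda>x. m' x * m x)"
      using exp_box_add[OF e(2) e'(2)] by (auto intro!: lincomb_on_base)
  qed
  then show "poly_span T (E + E') (\<lambda>x. m x * g x)" by (simp add: mult.commute)
qed

lemma poly_span_one: "poly_span T E (\<lambda>x. 1)"
proof -
  have "(\<lambda>_. 0) \<in> exp_box T E" by (simp add: exp_box_def)
  then have "poly_span T E (monom_fun (\<lambda>_. 0))" by (intro lincomb_on_base imageI) auto
  then show ?thesis by (rule lincomb_on_cong[rotated]) simp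
qed

lemma poly_span_prod:
  assumes "finite A" "\<And>a. a \<in> A \<Longrightarrow> \<exists>E. poly_span T E (f a)"
  shows "\<exists>E. poly_span T E (\<lambda>x. \<Prod>a\<in>A. f a x)"
  using assms
proof (induction A rule: finite_induct)
  case empty
  then show ?case using poly_span_one by auto
next
  case (insert a A)
  then obtain E E' where "poly_span T E (f a)" "poly_span T E' (\<lambda>x. \<Prod>a\<in>A. f a x)" by blast
  from poly_span_mult[OF this] show ?case using insert.hyps by auto
qed

lemma poly_span_uniform:
  assumes "finite A" "\<And>a. a \<in> A \<Longrightarrow> \<exists>E. poly_span T E (f a)"
  shows "\<exists>E. \<forall>a\<in>A. poly_span T E (f a)"
  using assms
proof (induction A rule: finite_induct)
  case (insert a A)
  then obtain E E' where E: "poly_span T E (f a)" "\<forall>a\<in>A. poly_span T E' (f a)" by blast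
  have "\<forall>b\<in>insert a A. poly_span T (max E E') (f b)"
    using poly_span_mono[OF E(1), of "max E E'"] E(2) poly_span_mono[of T E' _ "max E E'"] by auto
  then show ?case by blast
qed simp

text \<open>Restricting a relation between \<open>x\<^sub>j\<close> and the coordinates in \<open>T\<close> to the subspace where all other
  coordinates vanish, and sorting by powers of \<open>x\<^sub>j\<close>, gives a polynomial equation for \<open>x\<^sub>j\<close>. Its
  degree is positive and its leading coefficient does not vanish on \<open>V\<close>, since the coordinates in \<open>T\<close>
  are independent.\<close>

lemma dependent_coordinate_relation:
  fixes V :: "('k::comm_ring_1 ^ 'n::finite) set"
  assumes T: "alg_indep T V" and j: "j \<notin> T" and dep: "\<not> alg_indep (insert j T) V"
  shows "\<exists>c e. e \<ge> 1 \<and> (\<forall>i. \<exists>E. poly_span T E (c i)) \<and> (\<exists>x\<in>V. c e x \<noteq> 0) \<and>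
    (\<forall>x\<in>V. (\<Sum>i\<le>e. c i x * x $ j ^ i) = 0)"
proof -
  obtain p where p: "p \<in> vanishing_ideal V" "p \<in> nonzero_polys (insert j T)"
    using dep by (auto simp: alg_indep_def)
  let ?K = "Poly_Mapping.keys p" and ?l = "Poly_Mapping.lookup"
  \<comment> \<open>The factors \<open>0 ^ _\<close> delete the monomials with a coordinate outside \<open>insert j T\<close>, as \<open>0 ^ 0 = 1\<close>.\<close>
  define w where "w = (\<lambda>m. ?l p m * (\<Prod>i\<in>- insert j T. 0 ^ ?l m i))"
  define r where "r = (\<lambda>(m :: 'n \<Rightarrow>\<^sub>0 nat) i. if i \<in> T then ?l m i else 0)"
  define E where "E = (\<Sum>m\<in>?K. \<Sum>i\<in>UNIV. ?l m i)"
  define c where "c = (\<lambda>i x. \<Sum>m\<in>{m\<in>?K. ?l m j = i}. w m * monom_fun (r m) x)"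
  have E: "?l m i \<le> E" if "m \<in> ?K" for m i
    unfolding E_def using that
    by (intro order_trans[OF member_le_sum[of i UNIV "?l m"] member_le_sum[of m ?K "\<lambda>m. \<Sum>i\<in>UNIV. ?l m i"]]) auto
  have poly: "poly_span T E (c i)" for i
  proof -
    have "r m \<in> exp_box T E" if "m \<in> ?K" for m using E[OF that] by (auto simp: r_def exp_box_def)
    then show ?thesis
      unfolding c_def by (intro lincomb_on_sum lincomb_on_scale lincomb_on_base) auto
  qed
  have ev: "mpoly_eval p x = (\<Sum>i\<le>E. c i x * x $ j ^ i)" for x
  proof -
    define y where "y = (\<chi> i. if i \<in> insert j T then x $ i else 0)"
    have "depends_only_on (insert j T) (mpoly_eval p)" using p(2) by (simp add: nonzero_polys_def)
    then have "mpoly_eval p x = mpoly_eval p y" unfolding depends_only_on_def by (auto simp: y_def)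
    also have "\<dots> = (\<Sum>m\<in>?K. w m * monom_fun (r m) x * x $ j ^ ?l m j)"
      unfolding mpoly_eval_def
    proof (rule sum.cong[OF refl])
      fix m
      have "(\<Prod>i\<in>UNIV. y $ i ^ ?l m i) = (\<Prod>i\<in>- insert j T. y $ i ^ ?l m i) * (\<Prod>i\<in>insert j T. y $ i ^ ?l m i)"
        by (subst prod.union_disjoint[symmetric]) (auto intro!: prod.cong)
      also have "(\<Prod>i\<in>- insert j T. y $ i ^ ?l m i) = (\<Prod>i\<in>- insert j T. 0 ^ ?l m i)"
        by (rule prod.cong) (auto simp: y_def)
      also have "(\<Prod>i\<in>insert j T. y $ i ^ ?l m i) = x $ j ^ ?l m j * (\<Prod>i\<in>T. x $ i ^ ?l m i)"
        using j by (subst prod.insert) (auto simp: y_def intro!: prod.cong)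
      also have "(\<Prod>i\<in>T. x $ i ^ ?l m i) = monom_fun (r m) x"
        unfolding monom_fun_def r_def by (rule prod.mono_neutral_cong_left) auto
      finally show "?l p m * (\<Prod>i\<in>UNIV. y $ i ^ ?l m i) = w m * monom_fun (r m) x * x $ j ^ ?l m j"
        by (simp add: w_def mult_ac)
    qed
    also have "\<dots> = (\<Sum>i\<le>E. \<Sum>m\<in>{m\<in>?K. ?l m j = i}. w m * monom_fun (r m) x * x $ j ^ ?l m j)"
      by (rule sum.group[symmetric]) (use E in auto)
    also have "\<dots> = (\<Sum>i\<le>E. c i x * x $ j ^ i)"
      unfolding c_def sum_distrib_right by (intro sum.cong) auto
    finally show ?thesis .
  qed
  define N where "N = {i. i \<le> E \<and> (\<exists>x. c i x \<noteq> 0)}"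
  define e where "e = Max N"
  have "finite N" by (simp add: N_def)
  have "N \<noteq> {}"
  proof
    assume "N = {}"
    then have "mpoly_eval p x = 0" for x unfolding ev N_def by (intro sum.neutral) auto
    then show False using p(2) by (auto simp: nonzero_polys_def)
  qed
  then have "e \<in> N" using \<open>finite N\<close> by (simp add: e_def)
  then obtain x0 where e: "e \<le> E" "c e x0 \<noteq> 0" by (auto simp: N_def)
  have zero: "c i x = 0" if "i \<le> E" "\<not> i \<le> e" for i x
    using that Max_ge[OF \<open>finite N\<close>, of i] by (auto simp: N_def e_def)
  have rel: "(\<Sum>i\<le>e. c i x * x $ j ^ i) = 0" if "x \<in> V" for x
  proof -
    have "(\<Sum>i\<le>e. c i x * x $ j ^ i) = (\<Sum>i\<le>E. c i x * x $ j ^ i)"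
      by (rule sum.mono_neutral_left) (use e zero in auto)
    also have "\<dots> = 0" using p(1) that by (simp add: ev[symmetric] vanishing_ideal_def)
    finally show ?thesis .
  qed
  obtain x1 where x1: "x1 \<in> V" "c e x1 \<noteq> 0"
    using alg_indepD[OF T poly_span_is_poly poly_span_depends_only_on, OF poly poly e(2)] by blast
  have "e \<noteq> 0"
  proof
    assume "e = 0"
    then show False using rel[OF x1(1)] x1(2) by simp
  qed
  then have "e \<ge> 1" by simp
  then show ?thesis using poly rel x1 by blast
qed

text \<open>Let \<open>C\<close> be the product of the leading coefficients of the equations for the \<open>x\<^sub>j\<close> with
  \<open>j \<notin> T\<close>. Multiplication by \<open>C\<close> allows one to lower the exponent of \<open>x\<^sub>j\<close> below the degree
  \<open>\<epsilon> j\<close> of its equation, at the price of a bounded number of further factors of each coordinate in \<open>T\<close>.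
  So \<open>C ^ L\<close> times a monomial of degree \<open>L\<close> is a combination of monomials in which only the exponents on \<open>T\<close>
  grow with \<open>L\<close>, and they grow linearly. Where \<open>C\<close> does not vanish one can divide by \<open>C ^ L\<close> again.\<close>

lemma growth_le_of_maximal_alg_indep:
  fixes V :: "('k::real_normed_field ^ 'n::finite) set"
  assumes V: "zariski_irreducible V" and T: "alg_indep T V"
    and max: "\<And>j. j \<notin> T \<Longrightarrow> \<not> alg_indep (insert j T) V"
  shows "\<exists>c. is_poly c \<and> (\<exists>x\<in>V. c x \<noteq> 0) \<and> growth_le {x\<in>V. c x \<noteq> 0} (card T)"
proof -
  have "\<forall>j\<in>-T. \<exists>c e. e \<ge> 1 \<and> (\<forall>i. \<exists>E. poly_span T E (c i)) \<and> (\<exists>x\<in>V. c e x \<noteq> 0) \<and>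
    (\<forall>x\<in>V. (\<Sum>i\<le>e. c i x * x $ j ^ i) = 0)"
    using dependent_coordinate_relation[OF T _ max] by blast
  from bchoice[OF this] obtain c where "\<forall>j\<in>-T. \<exists>e. e \<ge> 1 \<and> (\<forall>i. \<exists>E. poly_span T E (c j i)) \<and>
    (\<exists>x\<in>V. c j e x \<noteq> 0) \<and> (\<forall>x\<in>V. (\<Sum>i\<le>e. c j i x * x $ j ^ i) = 0)" ..
  from bchoice[OF this] obtain \<epsilon> where *: "\<forall>j\<in>-T. \<epsilon> j \<ge> 1 \<and> (\<forall>i. \<exists>E. poly_span T E (c j i)) \<and>
    (\<exists>x\<in>V. c j (\<epsilon> j) x \<noteq> 0) \<and> (\<forall>x\<in>V. (\<Sum>i\<le>\<epsilon> j. c j i x * x $ j ^ i) = 0)" ..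
  have \<epsilon>: "\<epsilon> j \<ge> 1" and c: "\<exists>E. poly_span T E (c j i)" and nz: "\<exists>x\<in>V. c j (\<epsilon> j) x \<noteq> 0"
    and rel: "\<And>x. x \<in> V \<Longrightarrow> (\<Sum>i\<le>\<epsilon> j. c j i x * x $ j ^ i) = 0" if "j \<notin> T" for i j
    using * that by blast+
  define C where "C = (\<lambda>x. \<Prod>j\<in>-T. c j (\<epsilon> j) x)"
  \<comment> \<open>\<open>b (j, i)\<close> is the coefficient of \<open>x\<^sub>j ^ i\<close> after the equation for \<open>x\<^sub>j\<close> is multiplied to get leading coefficient \<open>C\<close>.\<close>
  define b where "b = (\<lambda>(j, i) x. (\<Prod>j'\<in>-T-{j}. c j' (\<epsilon> j') x) * c j i x)"
  have "\<exists>E. poly_span T E C"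
    unfolding C_def by (rule poly_span_prod) (use c in auto)
  then obtain E1 where E1: "poly_span T E1 C" ..
  have "\<exists>E. poly_span T E (b p)" if p: "p \<in> (SIGMA j:-T. {..<\<epsilon> j})" for p
  proof -
    obtain j i where p: "p = (j, i)" "j \<notin> T" using p by auto
    have "\<exists>E. poly_span T E (\<lambda>x. \<Prod>j'\<in>-T-{j}. c j' (\<epsilon> j') x)"
      by (rule poly_span_prod) (use c in auto)
    then obtain E where "poly_span T E (\<lambda>x. \<Prod>j'\<in>-T-{j}. c j' (\<epsilon> j') x)" ..
    moreover obtain E' where "poly_span T E' (c j i)" using c p(2) by blast
    ultimately show ?thesis unfolding b_def p(1) prod.case by (intro exI) (rule poly_span_mult)
  qed
  then have "\<exists>E. \<forall>p\<in>(SIGMA j:-T. {..<\<epsilon> j}). poly_span T E (b p)"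
    by (intro poly_span_uniform) auto
  then obtain E2 where E2: "\<forall>p\<in>(SIGMA j:-T. {..<\<epsilon> j}). poly_span T E2 (b p)" ..
  define E where "E = max E1 E2"
  have C: "poly_span T E C" using poly_span_mono[OF E1] by (simp add: E_def)
  have b: "poly_span T E (b (j, i))" if "j \<notin> T" "i < \<epsilon> j" for j i
    using poly_span_mono[of T E2 "b (j, i)" E] E2 that by (auto simp: E_def)
  have reduce: "C x * x $ j ^ \<epsilon> j = (\<Sum>i<\<epsilon> j. - b (j, i) x * x $ j ^ i)" if j: "j \<notin> T" and x: "x \<in> V" for j x
  proof -
    let ?D = "\<Prod>j'\<in>-T-{j}. c j' (\<epsilon> j') x"
    have "C x = c j (\<epsilon> j) x * ?D" unfolding C_def using j by (subst prod.remove[of _ j]) auto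
    then have "C x * x $ j ^ \<epsilon> j + (\<Sum>i<\<epsilon> j. b (j, i) x * x $ j ^ i) = ?D * (\<Sum>i\<le>\<epsilon> j. c j i x * x $ j ^ i)"
      by (simp add: b_def lessThan_Suc_atMost[symmetric] sum_distrib_left distrib_left mult_ac)
    then show ?thesis using rel[OF j x] by (simp add: sum_negf eq_neg_iff_add_eq_0)
  qed
  define B where "B = (\<lambda>K. {e :: 'n \<Rightarrow> nat. \<forall>i. if i \<in> T then e i \<le> K else e i < \<epsilon> i})"
  define M where "M = (\<lambda>K f. lincomb_on V (monom_fun ` B K) (f :: 'k ^ 'n \<Rightarrow> 'k))"
  have B_PiE: "B K = PiE UNIV (\<lambda>i. if i \<in> T then {..K} else {..<\<epsilon> i})" for K
    by (auto simp: B_def PiE_def Pi_def split: if_splits)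
  have finB: "finite (B K)" for K unfolding B_PiE by (rule finite_PiE) auto
  have cardB: "card (B K) = (K + 1) ^ card T * (\<Prod>i\<in>-T. \<epsilon> i)" for K
  proof -
    have "card (B K) = (\<Prod>i\<in>UNIV. if i \<in> T then K + 1 else \<epsilon> i)"
      unfolding B_PiE by (subst card_PiE) (auto intro!: prod.cong)
    also have "\<dots> = (\<Prod>i\<in>T. if i \<in> T then K + 1 else \<epsilon> i) * (\<Prod>i\<in>-T. if i \<in> T then K + 1 else \<epsilon> i)"
      by (subst prod.union_disjoint[symmetric]) (auto intro!: prod.cong)
    also have "(\<Prod>i\<in>T. if i \<in> T then K + 1 else \<epsilon> i) = (K + 1) ^ card T" by (simp cong: prod.cong)
    also have "(\<Prod>i\<in>-T. if i \<in> T then K + 1 else \<epsilon> i) = (\<Prod>i\<in>-T. \<epsilon> i)" by (rule prod.cong) auto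
    finally show ?thesis .
  qed
  have M_base: "M K (monom_fun e)" if "e \<in> B K" for e K
    unfolding M_def by (rule lincomb_on_base) (use that finB in auto)
  have M_mono: "M K' f" if "M K f" "K \<le> K'" for f K K'
  proof -
    have "B K \<subseteq> B K'" unfolding B_def using \<open>K \<le> K'\<close> by (auto split: if_splits intro: le_trans)
    then show ?thesis using \<open>M K f\<close> finB unfolding M_def
      by (meson lincomb_on_mono image_mono finite_imageI)
  qed
  have M_mult: "M (K + E') (\<lambda>x. f x * g x)" if f: "poly_span T E' f" and g: "M K g" for K E' f g
    unfolding M_def
  proof (rule lincomb_on_mult)
    show "lincomb_on V (monom_fun ` exp_box T E') f" using lincomb_on_subset[OF f] by simp
    fix m :: "'k ^ 'n \<Rightarrow> 'k" assume "m \<in> monom_fun ` exp_box T E'"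
    then obtain e where e: "m = monom_fun e" "e \<in> exp_box T E'" by blast
    have "lincomb_on V (monom_fun ` B (K + E')) (\<lambda>x. g x * m x)"
    proof (rule lincomb_on_mult[OF g[unfolded M_def]])
      fix m' :: "'k ^ 'n \<Rightarrow> 'k" assume "m' \<in> monom_fun ` B K"
      then obtain e' where e': "m' = monom_fun e'" "e' \<in> B K" by blast
      have eq: "(\<lambda>x. m' x * m x) = monom_fun (\<lambda>i. e' i + e i)"
        unfolding e e' by (simp add: monom_fun_add)
      have "(\<lambda>i. e' i + e i) \<in> B (K + E')"
        using e(2) e'(2) unfolding B_def exp_box_def by (auto simp: add_mono split: if_splits)
      then show "lincomb_on V (monom_fun ` B (K + E')) (\<lambda>x. m' x * m x)"
        unfolding eq using M_base[unfolded M_def] by blast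
    qed
    then show "lincomb_on V (monom_fun ` B (K + E')) (\<lambda>x. m x * g x)" by (simp add: mult.commute)
  qed
  have M_step: "M (K + E + 1) (\<lambda>x. C x * x $ i * monom_fun e x)" if e: "e \<in> B K" for K i e
  proof (cases "i \<in> T \<or> e i + 1 < \<epsilon> i")
    case True
    then have "e(i := Suc (e i)) \<in> B (K + 1)"
      using e unfolding B_def by (auto split: if_splits intro: le_SucI)
    from M_mult[OF C M_base[OF this]] have "M (K + E + 1) (\<lambda>x. C x * monom_fun (e(i := Suc (e i))) x)"
      by (simp add: add_ac)
    then show ?thesis by (simp add: monom_fun_Suc[symmetric] mult.assoc)
  next
    case False
    then have i: "i \<notin> T" "Suc (e i) = \<epsilon> i" using e unfolding B_def by (auto split: if_splits dest: spec[of _ i])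
    have "M (K + E) (\<lambda>x. b (i, k) x * monom_fun (e(i := k)) x)" if "k < \<epsilon> i" for k
    proof -
      have "e(i := k) \<in> B K" using e i that unfolding B_def by auto
      from M_mult[OF b[OF i(1) that] M_base[OF this]] show ?thesis .
    qed
    then have "M (K + E) (\<lambda>x. \<Sum>k<\<epsilon> i. (- 1) * (b (i, k) x * monom_fun (e(i := k)) x))"
      unfolding M_def by (intro lincomb_on_sum lincomb_on_scale) auto
    then have "M (K + E) (\<lambda>x. C x * x $ i * monom_fun e x)"
      unfolding M_def
    proof (rule lincomb_on_cong[rotated])
      fix x assume x: "x \<in> V"
      have "C x * x $ i * monom_fun e x = C x * x $ i ^ \<epsilon> i * monom_fun (e(i := 0)) x"
        using monom_fun_Suc[of x i e] monom_fun_upd[of e i "Suc (e i)" x] i(2) by (simp add: mult.assoc)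
      also have "\<dots> = (\<Sum>k<\<epsilon> i. - b (i, k) x * x $ i ^ k) * monom_fun (e(i := 0)) x"
        by (simp only: reduce[OF i(1) x])
      also have "\<dots> = (\<Sum>k<\<epsilon> i. (- 1) * (b (i, k) x * monom_fun (e(i := k)) x))"
        unfolding sum_distrib_right
      proof (rule sum.cong[OF refl])
        fix k
        show "- b (i, k) x * x $ i ^ k * monom_fun (e(i := 0)) x = (- 1) * (b (i, k) x * monom_fun (e(i := k)) x)"
          using monom_fun_upd[of e i k x] by simp
      qed
      finally show "(\<Sum>k<\<epsilon> i. (- 1) * (b (i, k) x * monom_fun (e(i := k)) x)) = C x * x $ i * monom_fun e x"
        by simp
    qed
    then show ?thesis by (rule M_mono) simp
  qed
  have M_power: "M (L * (E + 1)) (\<lambda>x. C x ^ L * monom_fun e x)" if "(\<Sum>i\<in>UNIV. e i) \<le> L" for L e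
    using that
  proof (induction L arbitrary: e)
    case 0
    then have "e = (\<lambda>_. 0)" by auto
    moreover have "(\<lambda>_. 0) \<in> B 0" using \<epsilon> by (auto simp: B_def Suc_le_eq)
    moreover have "monom_fun (\<lambda>_. 0) = (\<lambda>x :: 'k ^ 'n. 1)" by auto
    ultimately show ?case using M_base[of "\<lambda>_. 0" 0] by simp
  next
    case (Suc L)
    show ?case
    proof (cases "\<exists>i. e i > 0")
      case True
      then obtain i where i: "e i > 0" ..
      define e' where "e' = e(i := e i - 1)"
      have "(\<Sum>i\<in>UNIV. e i) = (\<Sum>k\<in>UNIV. e' k + (if k = i then 1 else 0))"
        by (rule sum.cong) (use i in \<open>auto simp: e'_def\<close>)
      also have "\<dots> = (\<Sum>i\<in>UNIV. e' i) + 1" by (simp add: sum.distrib)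
      finally have "(\<Sum>i\<in>UNIV. e' i) \<le> L" using Suc.prems by simp
      from Suc.IH[OF this] have "lincomb_on V (monom_fun ` B (L * (E + 1))) (\<lambda>x. C x ^ L * monom_fun e' x)"
        unfolding M_def .
      then have "M (L * (E + 1) + E + 1) (\<lambda>x. C x ^ L * monom_fun e' x * (C x * x $ i))"
        unfolding M_def
      proof (rule lincomb_on_mult)
        fix m :: "'k ^ 'n \<Rightarrow> 'k" assume "m \<in> monom_fun ` B (L * (E + 1))"
        then obtain e where e: "m = monom_fun e" "e \<in> B (L * (E + 1))" by blast
        from M_step[OF e(2), of i]
        show "lincomb_on V (monom_fun ` B (L * (E + 1) + E + 1)) (\<lambda>x. m x * (C x * x $ i))"
          unfolding M_def e(1) by (simp add: mult_ac)
      qed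
      moreover have "e = e'(i := Suc (e' i))" using i by (auto simp: e'_def)
      then have "monom_fun e x = x $ i * monom_fun e' x" for x :: "'k ^ 'n" using monom_fun_Suc[of x i e'] by simp
      then have "(\<lambda>x. C x ^ L * monom_fun e' x * (C x * x $ i)) = (\<lambda>x. C x ^ Suc L * monom_fun e x)"
        by (simp add: fun_eq_iff mult_ac)
      ultimately show ?thesis by (simp add: add_ac)
    next
      case False
      then have "(\<Sum>i\<in>UNIV. e i) \<le> L" by auto
      from M_mult[OF C Suc.IH[OF this]]
      have "M (L * (E + 1) + E) (\<lambda>x. C x * (C x ^ L * monom_fun e x))" .
      from M_mono[OF this, of "Suc L * (E + 1)"] show ?thesis by (simp add: mult.assoc)
    qed
  qed
  have "growth_le {x\<in>V. C x \<noteq> 0} (card T)"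
    unfolding growth_le_def
  proof (intro exI allI conjI ballI)
    fix K
    define L where "L = CARD('n) * K"
    define H where "H = (\<lambda>h x. h x * inverse (C x ^ L)) ` monom_fun ` B (L * (E + 1))"
    show "finite H" using finB by (simp add: H_def)
    have "card H \<le> card (B (L * (E + 1)))"
      unfolding H_def image_image using finB by (rule card_image_le)
    also have "\<dots> = (L * (E + 1) + 1) ^ card T * (\<Prod>i\<in>-T. \<epsilon> i)" by (rule cardB)
    also have "\<dots> \<le> ((CARD('n) * (E + 1) + 1) * (K + 1)) ^ card T * (\<Prod>i\<in>-T. \<epsilon> i)"
      by (intro mult_right_mono power_mono) (auto simp: L_def algebra_simps)
    also have "\<dots> = ((CARD('n) * (E + 1) + 1) ^ card T * (\<Prod>i\<in>-T. \<epsilon> i)) * (K + 1) ^ card T"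
      unfolding power_mult_distrib by (simp only: mult_ac)
    finally show "card H \<le> ((CARD('n) * (E + 1) + 1) ^ card T * (\<Prod>i\<in>-T. \<epsilon> i)) * (K + 1) ^ card T" .
    fix e :: "'n \<Rightarrow> nat" assume e: "e \<in> exp_box UNIV K"
    have "(\<Sum>i\<in>UNIV. e i) \<le> (\<Sum>i\<in>(UNIV :: 'n set). K)"
      by (rule sum_mono) (use e in \<open>auto simp: exp_box_def\<close>)
    then have "(\<Sum>i\<in>UNIV. e i) \<le> L" by (simp add: L_def)
    from M_power[OF this] have "lincomb_on V (monom_fun ` B (L * (E + 1))) (\<lambda>x. C x ^ L * monom_fun e x)"
      unfolding M_def .
    then have "lincomb_on {x\<in>V. C x \<noteq> 0} (monom_fun ` B (L * (E + 1))) (\<lambda>x. C x ^ L * monom_fun e x)"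
      by (rule lincomb_on_subset) auto
    then have "lincomb_on {x\<in>V. C x \<noteq> 0} H (\<lambda>x. C x ^ L * monom_fun e x * inverse (C x ^ L))"
      by (rule lincomb_on_mult) (auto simp: H_def finB intro!: lincomb_on_base)
    then show "lincomb_on {x\<in>V. C x \<noteq> 0} H (monom_fun e)"
      by (rule lincomb_on_cong[rotated]) (simp add: field_simps)
  qed
  moreover have "\<exists>x\<in>V. C x \<noteq> 0"
    unfolding C_def
  proof (rule zariski_irreducible_prod_nonzero[OF V])
    fix j assume "j \<in> -T"
    then show "is_poly (c j (\<epsilon> j)) \<and> (\<exists>x\<in>V. c j (\<epsilon> j) x \<noteq> 0)"
      using nz[of j] c[of j "\<epsilon> j"] poly_span_is_poly by blast
  qed simp
  ultimately show ?thesis using poly_span_is_poly[OF C] by blast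
qed

lemma growth_le_of_alg_dim_le:
  fixes V :: "('k::real_normed_field ^ 'n::finite) set"
  assumes V: "zariski_irreducible V" and d: "alg_dim V \<le> enat d"
  shows "\<exists>Z\<subseteq>V. dense_in Z V \<and> growth_le Z d"
proof -
  have indep_empty: "alg_indep {} V"
  proof -
    obtain x where x: "x \<in> V" using V by (auto simp: zariski_irreducible_def)
    have "mpoly_eval p x \<noteq> 0" if "p \<in> nonzero_polys {}" for p
    proof -
      obtain y where "mpoly_eval p y \<noteq> 0" using \<open>p \<in> nonzero_polys {}\<close> by (auto simp: nonzero_polys_def)
      moreover have "mpoly_eval p x = mpoly_eval p y"
        using \<open>p \<in> nonzero_polys {}\<close> unfolding nonzero_polys_def depends_only_on_def by blast
      ultimately show ?thesis by simp
    qed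
    then show ?thesis using x by (auto simp: alg_indep_def vanishing_ideal_def)
  qed
  have "\<forall>T. alg_indep T V \<longrightarrow> card T < Suc CARD('n)" by (auto simp: less_Suc_eq_le intro: card_mono)
  from ex_has_greatest_nat[of "\<lambda>T. alg_indep T V", OF indep_empty this]
  obtain T where T: "alg_indep T V" and max: "\<And>T'. alg_indep T' V \<Longrightarrow> card T' \<le> card T" by blast
  have "enat (card T) \<le> enat d"
    using card_le_alg_dim[of V T] T d unfolding alg_indep_def by (meson order_trans)
  then have card: "card T \<le> d" by simp
  have "\<not> alg_indep (insert j T) V" if "j \<notin> T" for j
    using max[of "insert j T"] that by auto
  from growth_le_of_maximal_alg_indep[OF V T this]
  obtain c where c: "is_poly c" "\<exists>x\<in>V. c x \<noteq> 0" "growth_le {x\<in>V. c x \<noteq> 0} (card T)" by blast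
  have "growth_le {x\<in>V. c x \<noteq> 0} d"
  proof -
    obtain C where C: "\<And>K. \<exists>H. finite H \<and> card H \<le> C * (K + 1) ^ card T \<and>
       (\<forall>e\<in>exp_box UNIV K. lincomb_on {x\<in>V. c x \<noteq> 0} H (monom_fun e))"
      using c(3) unfolding growth_le_def by blast
    have "C * (K + 1) ^ card T \<le> C * (K + 1) ^ d" for K
      by (intro mult_left_mono power_increasing card) auto
    then show ?thesis
      unfolding growth_le_def using C by (meson order_trans)
  qed
  then show ?thesis
    using dense_in_nonvanishing[OF V c(1,2)] by (intro exI[of _ "{x\<in>V. c x \<noteq> 0}"]) auto
qed

section \<open>Counting monomials on the incidence variety\<close>

definition pair_monoms :: "'m::finite set \<Rightarrow> 'n::finite set \<Rightarrow> nat \<Rightarrow> (('k::comm_ring_1 ^ 'm) \<times> ('k ^ 'n) \<Rightarrow> 'k) set" where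
  "pair_monoms A B K = (\<lambda>(a, b) (x, y). monom_fun a x * monom_fun b y) ` (exp_box A K \<times> exp_box B K)"

lemma pair_monoms_mono: "K \<le> K' \<Longrightarrow> pair_monoms A B K \<subseteq> pair_monoms A B K'"
  unfolding pair_monoms_def by (intro image_mono Sigma_mono exp_box_mono) auto

lemma finite_pair_monoms [simp]: "finite (pair_monoms A B K)"
  by (simp add: pair_monoms_def)

lemma pair_monomsI: "a \<in> exp_box A K \<Longrightarrow> b \<in> exp_box B K \<Longrightarrow>
    (\<lambda>(x, y). monom_fun a x * monom_fun b y) \<in> pair_monoms A B K"
  unfolding pair_monoms_def by force

lemma pair_monoms_mult:
  fixes f g :: "('k::comm_ring_1 ^ 'm::finite) \<times> ('k ^ 'n::finite) \<Rightarrow> 'k"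
  assumes f: "lincomb_on UNIV (pair_monoms A B K) f" and g: "lincomb_on UNIV (pair_monoms A B K') g"
  shows "lincomb_on UNIV (pair_monoms A B (K + K')) (\<lambda>p. f p * g p)"
proof (rule lincomb_on_mult[OF f])
  fix m :: "('k ^ 'm) \<times> ('k ^ 'n) \<Rightarrow> 'k" assume "m \<in> pair_monoms A B K"
  then obtain a b where m: "m = (\<lambda>(x, y). monom_fun a x * monom_fun b y)"
    and ab: "a \<in> exp_box A K" "b \<in> exp_box B K"
    by (auto simp: pair_monoms_def)
  have "lincomb_on UNIV (pair_monoms A B (K + K')) (\<lambda>p. g p * m p)"
  proof (rule lincomb_on_mult[OF g])
    fix m' :: "('k ^ 'm) \<times> ('k ^ 'n) \<Rightarrow> 'k" assume "m' \<in> pair_monoms A B K'"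
    then obtain a' b' where m': "m' = (\<lambda>(x, y). monom_fun a' x * monom_fun b' y)"
      and ab': "a' \<in> exp_box A K'" "b' \<in> exp_box B K'"
      by (auto simp: pair_monoms_def)
    have eq: "(\<lambda>p. m' p * m p) = (\<lambda>(x, y). monom_fun (\<lambda>i. a i + a' i) x * monom_fun (\<lambda>i. b i + b' i) y)"
      by (auto simp: m m' monom_fun_add[symmetric] fun_eq_iff mult_ac)
    show "lincomb_on UNIV (pair_monoms A B (K + K')) (\<lambda>p. m' p * m p)"
      unfolding eq by (intro lincomb_on_base pair_monomsI exp_box_add ab ab') simp
  qed
  then show "lincomb_on UNIV (pair_monoms A B (K + K')) (\<lambda>p. m p * g p)" by (simp add: mult.commute)
qed

lemma pair_monoms_one: "lincomb_on UNIV (pair_monoms A B K) (\<lambda>p. 1)"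
proof -
  have "lincomb_on UNIV (pair_monoms A B K) (\<lambda>(x, y). monom_fun (\<lambda>_. 0) x * monom_fun (\<lambda>_. 0) y)"
    by (intro lincomb_on_base pair_monomsI) (auto simp: exp_box_def)
  then show ?thesis by (rule lincomb_on_cong[rotated]) auto
qed

text \<open>Substituting maps of degree at most one in every variable into a monomial bounds each exponent by the total
  degree of the monomial. The crude bound suffices, as only the order of growth matters.\<close>

lemma pair_monoms_monom:
  assumes "\<And>p. lincomb_on UNIV (pair_monoms A B 1) (\<lambda>q. \<phi> q $ p)"
  shows "lincomb_on UNIV (pair_monoms A B (\<Sum>p\<in>UNIV. e p)) (\<lambda>q. monom_fun e (\<phi> q))"
proof -
  have pow: "lincomb_on UNIV (pair_monoms A B k) (\<lambda>q. (\<phi> q $ p) ^ k)" for p k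
  proof (induction k)
    case 0
    then show ?case by (simp add: pair_monoms_one)
  next
    case (Suc k)
    from pair_monoms_mult[OF assms[of p] this] show ?case by simp
  qed
  have "lincomb_on UNIV (pair_monoms A B (\<Sum>p\<in>S. e p)) (\<lambda>q. \<Prod>p\<in>S. (\<phi> q $ p) ^ e p)" for S
  proof (induction S rule: infinite_finite_induct)
    case (insert p S)
    from pair_monoms_mult[OF pow[of "e p" p] insert.IH] show ?case using insert.hyps by simp
  qed (simp_all add: pair_monoms_one)
  from this[of UNIV] show ?thesis unfolding monom_fun_def .
qed

lemma pair_monoms_fst:
  assumes "i \<in> A"
  shows "lincomb_on UNIV (pair_monoms A B 1) (\<lambda>q. fst q $ i)"
proof -
  have "lincomb_on UNIV (pair_monoms A B 1) (\<lambda>(x, y). monom_fun ((\<lambda>_. 0)(i := 1)) x * monom_fun (\<lambda>_. 0) y)"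
    using assms by (intro lincomb_on_base pair_monomsI) (auto simp: exp_box_def)
  then show ?thesis by (rule lincomb_on_cong[rotated]) (auto simp: monom_fun_unit[simplified])
qed

lemma pair_monoms_snd:
  assumes "i \<in> B"
  shows "lincomb_on UNIV (pair_monoms A B 1) (\<lambda>q. snd q $ i)"
proof -
  have "lincomb_on UNIV (pair_monoms A B 1) (\<lambda>(x, y). monom_fun (\<lambda>_. 0) x * monom_fun ((\<lambda>_. 0)(i := 1)) y)"
    using assms by (intro lincomb_on_base pair_monomsI) (auto simp: exp_box_def)
  then show ?thesis by (rule lincomb_on_cong[rotated]) (auto simp: monom_fun_unit[simplified])
qed

lemma pair_monoms_fst_mult_snd:
  assumes "i \<in> A" "l \<in> B"
  shows "lincomb_on UNIV (pair_monoms A B 1) (\<lambda>q. fst q $ i * snd q $ l)"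
proof -
  have "lincomb_on UNIV (pair_monoms A B 1) (\<lambda>(x, y). monom_fun ((\<lambda>_. 0)(i := 1)) x * monom_fun ((\<lambda>_. 0)(l := 1)) y)"
    using assms by (intro lincomb_on_base pair_monomsI) (auto simp: exp_box_def)
  then show ?thesis by (rule lincomb_on_cong[rotated]) (auto simp: monom_fun_unit[simplified])
qed

text \<open>For \<open>z $ j \<noteq> 0\<close> the equation \<open>M *v z = 0\<close> determines column \<open>j\<close> of \<open>M\<close> from the other columns. Scaling
  these by \<open>z $ j\<close> avoids denominators, and the entries of the parametrization become bilinear in \<open>z\<close> and
  \<open>u\<close>.\<close>

definition kernel_param :: "'n::finite \<Rightarrow> ('k::comm_ring_1 ^ 'n) \<times> ('k ^ ('s::finite \<times> 'n)) \<Rightarrow> 'k ^ ('s \<times> 'n)" where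
  "kernel_param j = (\<lambda>(z, u). \<chi> p. if snd p \<noteq> j then z $ j * u $ p
      else - (\<Sum>l\<in>UNIV-{j}. z $ l * u $ (fst p, l)))"

lemma kernel_param_surj:
  fixes z :: "'k::field ^ 'n::finite" and u :: "'k ^ ('s::finite \<times> 'n)"
  assumes "matrix_of_vec u *v z = 0" "z $ j \<noteq> 0"
  shows "kernel_param j (z, \<chi> p. u $ p / z $ j) = u"
proof -
  have "(\<Sum>l\<in>UNIV. u $ (i, l) * z $ l) = 0" for i
    using arg_cong[OF assms(1), of "\<lambda>v. v $ i"] by (simp add: matrix_vector_mult_def matrix_of_vec_def)
  then have "u $ (i, j) * z $ j + (\<Sum>l\<in>UNIV-{j}. u $ (i, l) * z $ l) = 0" for i
    by (subst (asm) sum.remove[of _ j]) auto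
  then have *: "- (\<Sum>l\<in>UNIV-{j}. u $ (i, l) * z $ l) = u $ (i, j) * z $ j" for i
    by (simp add: eq_neg_iff_add_eq_0 neg_eq_iff_add_eq_0 add.commute)
  have "- (\<Sum>l\<in>UNIV-{j}. z $ l * (u $ (i, l) / z $ j)) = u $ (i, j)" for i
  proof -
    have "- (\<Sum>l\<in>UNIV-{j}. z $ l * (u $ (i, l) / z $ j)) = - (\<Sum>l\<in>UNIV-{j}. u $ (i, l) * z $ l) / z $ j"
      by (simp add: sum_divide_distrib mult_ac)
    then show ?thesis using * assms(2) by simp
  qed
  then show ?thesis
    using assms(2) by (auto simp: kernel_param_def vec_eq_iff)
qed

text \<open>The incidence variety of pairs \<open>(z, M)\<close> with \<open>M *v z = 0\<close> and \<open>z $ j \<noteq> 0\<close> has fewer dimensions than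
  the space of matrices: \<open>d\<close> for \<open>z\<close> and \<open>s * (n - 1)\<close> for the free columns, which is less than
  \<open>s * n\<close>. In terms of Hilbert functions, the \<open>(N + 1) ^ (s * n)\<close> monomials in the entries of \<open>M\<close>, pulled back
  along \<open>kernel_param\<close>, lie in a space whose dimension is of order at most \<open>s * n - 1\<close> in \<open>N\<close>. For large
  \<open>N\<close> there is a linear relation between them, and this is an equation for the matrices to be avoided.\<close>

lemma generic_matrix_avoids_kernel_param:
  fixes Z \<Delta> :: "('k::real_normed_field ^ 'n::finite) set"
  assumes Z: "growth_le Z d" "dense_in Z \<Delta>" and d: "d < CARD('s::finite)"
  shows "\<exists>q :: 'k ^ ('s \<times> 'n) \<Rightarrow> 'k. is_poly q \<and> (\<exists>u. q u \<noteq> 0) \<and>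
    (\<forall>u. \<forall>z\<in>\<Delta>. z $ j \<noteq> 0 \<longrightarrow> matrix_of_vec u *v z = 0 \<longrightarrow> q u = 0)"
proof -
  obtain C where C: "\<And>K. \<exists>H. finite H \<and> card H \<le> C * (K + 1) ^ d \<and>
     (\<forall>e\<in>exp_box UNIV K. lincomb_on Z H (monom_fun e))"
    using Z(1) unfolding growth_le_def by blast
  let ?m = "CARD('s) * CARD('n)"
  let ?S = "UNIV \<times> (UNIV - {j}) :: ('s \<times> 'n) set"
  \<comment> \<open>With \<open>L + 1 \<le> ?m * (N + 1)\<close>, the bound \<open>C * (L + 1) ^ (?m - 1)\<close> is at most \<open>N * (N + 1) ^ (?m - 1)\<close>, hence
    less than the number \<open>(N + 1) ^ ?m\<close> of monomials.\<close>
  define N where "N = C * ?m ^ (?m - 1)"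
  define L where "L = ?m * N"
  obtain H where H: "finite H" "card H \<le> C * (L + 1) ^ d"
      "\<And>e. e \<in> exp_box UNIV L \<Longrightarrow> lincomb_on Z H (monom_fun e)"
    using C[of L] by blast
  define HH where "HH = (\<lambda>(h, b) (z, u). h z * monom_fun b u) ` (H \<times> exp_box ?S L)"
  have finHH: "finite HH" unfolding HH_def using H(1) by simp
  have m_pos: "?m > 0" by simp
  have cardS: "d + card ?S \<le> ?m - 1"
  proof -
    have "card ?S = CARD('s) * (CARD('n) - 1)" by (simp add: card_cartesian_product)
    also have "\<dots> = ?m - CARD('s)" by (simp add: diff_mult_distrib2)
    finally have "card ?S = ?m - CARD('s)" .
    moreover have "CARD('s) \<le> ?m" by simp
    ultimately show ?thesis using d by linarith
  qed
  have "card HH \<le> card H * card (exp_box ?S L)"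
    unfolding HH_def card_cartesian_product[symmetric] using H(1) by (intro card_image_le) simp
  also have "\<dots> \<le> C * (L + 1) ^ d * (L + 1) ^ card ?S"
    unfolding card_exp_box using H(2) by (rule mult_right_mono) simp
  also have "\<dots> = C * (L + 1) ^ (d + card ?S)" by (simp add: power_add)
  also have "\<dots> \<le> C * (L + 1) ^ (?m - 1)"
    by (intro mult_left_mono power_increasing cardS) auto
  also have "\<dots> \<le> C * (?m * (N + 1)) ^ (?m - 1)"
    using m_pos by (intro mult_left_mono power_mono) (auto simp: L_def)
  also have "\<dots> = N * (N + 1) ^ (?m - 1)"
    unfolding power_mult_distrib N_def by (simp only: mult.assoc)
  also have "\<dots> < (N + 1) * (N + 1) ^ (?m - 1)" by simp
  also have "\<dots> = (N + 1) ^ ?m" by (simp only: power_Suc[symmetric] Suc_diff_1[OF m_pos])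
  also have "\<dots> = card (exp_box (UNIV :: ('s \<times> 'n) set) N)" by (simp add: card_exp_box)
  finally have card: "card HH < card (exp_box (UNIV :: ('s \<times> 'n) set) N)" .
  have entry: "lincomb_on UNIV (pair_monoms UNIV ?S 1) (\<lambda>q. kernel_param j q $ p :: 'k)" for p :: "'s \<times> 'n"
  proof (cases "snd p = j")
    case False
    then have "lincomb_on UNIV (pair_monoms UNIV ?S 1) (\<lambda>q :: ('k ^ 'n) \<times> ('k ^ ('s \<times> 'n)). fst q $ j * snd q $ p)"
      by (intro pair_monoms_fst_mult_snd) (auto simp: mem_Times_iff)
    then show ?thesis
      by (rule lincomb_on_cong[rotated]) (use False in \<open>auto simp: kernel_param_def\<close>)
  next
    case True
    have "lincomb_on UNIV (pair_monoms UNIV ?S 1)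
      (\<lambda>q :: ('k ^ 'n) \<times> ('k ^ ('s \<times> 'n)). \<Sum>l\<in>UNIV-{j}. (- 1) * (fst q $ l * snd q $ (fst p, l)))"
      by (intro lincomb_on_sum lincomb_on_scale pair_monoms_fst_mult_snd) auto
    then show ?thesis
      by (rule lincomb_on_cong[rotated]) (use True in \<open>auto simp: kernel_param_def sum_negf\<close>)
  qed
  have span: "lincomb_on (Z \<times> UNIV) HH (\<lambda>q. monom_fun e (kernel_param j q))"
    if e: "e \<in> exp_box UNIV N" for e :: "'s \<times> 'n \<Rightarrow> nat"
  proof (rule lincomb_on_trans)
    have "(\<Sum>p\<in>UNIV. e p) \<le> (\<Sum>p\<in>(UNIV :: ('s \<times> 'n) set). N)"
      by (rule sum_mono) (use e in \<open>auto simp: exp_box_def\<close>)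
    then have "(\<Sum>p\<in>UNIV. e p) \<le> L" by (simp add: L_def)
    then have "lincomb_on UNIV (pair_monoms UNIV ?S L) (\<lambda>q. monom_fun e (kernel_param j q) :: 'k)"
      using lincomb_on_mono[OF pair_monoms_monom[OF entry] pair_monoms_mono] by simp
    then show "lincomb_on (Z \<times> UNIV) (pair_monoms UNIV ?S L) (\<lambda>q. monom_fun e (kernel_param j q))"
      by (rule lincomb_on_subset) simp
  next
    fix m :: "('k ^ 'n) \<times> ('k ^ ('s \<times> 'n)) \<Rightarrow> 'k" assume "m \<in> pair_monoms UNIV ?S L"
    then obtain a b where m: "m = (\<lambda>(x, y). monom_fun a x * monom_fun b y)"
      and ab: "a \<in> exp_box UNIV L" "b \<in> exp_box ?S L"
      by (auto simp: pair_monoms_def)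
    obtain c where c: "\<forall>z\<in>Z. monom_fun a z = (\<Sum>h\<in>H. c h * h z)"
      using H(3)[OF ab(1)] unfolding lincomb_on_def by blast
    have "lincomb_on (Z \<times> UNIV) HH (\<lambda>q. \<Sum>h\<in>H. c h * (\<lambda>(z, u). h z * monom_fun b u) q)"
      by (intro lincomb_on_sum lincomb_on_scale lincomb_on_base finHH) (use ab(2) in \<open>force simp: HH_def\<close>)
    then show "lincomb_on (Z \<times> UNIV) HH m"
      by (rule lincomb_on_cong[rotated]) (use c in \<open>auto simp: m sum_distrib_right sum_distrib_left mult_ac\<close>)
  qed
  from lincomb_on_dependent[OF finHH finite_exp_box card span]
  obtain l :: "('s \<times> 'n \<Rightarrow> nat) \<Rightarrow> 'k" where "(\<exists>e\<in>exp_box UNIV N. l e \<noteq> 0) \<and>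
      (\<forall>q\<in>Z \<times> UNIV. (\<Sum>e\<in>exp_box UNIV N. l e * monom_fun e (kernel_param j q)) = 0)" ..
  then have l: "\<exists>e\<in>exp_box UNIV N. l e \<noteq> 0"
      "\<forall>q\<in>Z \<times> UNIV. (\<Sum>e\<in>exp_box UNIV N. l e * monom_fun e (kernel_param j q)) = 0"
    by blast+
  define q where "q = (\<lambda>u :: 'k ^ ('s \<times> 'n). \<Sum>e\<in>exp_box UNIV N. l e * monom_fun e u)"
  have q: "is_poly q" unfolding q_def by (intro is_poly_intros)
  have "\<exists>u. q u \<noteq> 0"
    using monomials_independent[where A = UNIV and K = N and l = l] l(1) unfolding q_def by blast
  moreover have "q u = 0" if z: "z \<in> \<Delta>" "z $ j \<noteq> 0" "matrix_of_vec u *v z = 0" for u z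
  proof -
    let ?w = "\<chi> p. u $ p / z $ j"
    have "is_poly (\<lambda>z. kernel_param j (z, w) $ p)" for w :: "'k ^ ('s \<times> 'n)" and p
      by (cases "snd p = j") (simp_all add: kernel_param_def is_poly_intros)
    then have "is_poly (\<lambda>z. q (kernel_param j (z, ?w)))" by (rule is_poly_compose[OF q])
    moreover have "\<forall>z\<in>Z. q (kernel_param j (z, ?w)) = 0" using l(2) by (auto simp: q_def)
    ultimately have "\<forall>z\<in>\<Delta>. q (kernel_param j (z, ?w)) = 0" using Z(2) unfolding dense_in_def by blast
    then have "q (kernel_param j (z, ?w)) = 0" using z(1) by blast
    then show ?thesis by (simp add: kernel_param_surj[OF z(3,2)])
  qed
  ultimately show ?thesis using q by blast
qed

text \<open>Identifiability fails exactly when the kernel of \<open>M\<close> contains a nonzero difference. Such a difference has a nonzero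
  coordinate \<open>j\<close>, so it suffices that the product over \<open>j\<close> of the equations found above does not vanish.\<close>

lemma generic_linear_everywhere_identifiable:
  fixes X :: "('k::real_normed_field ^ 'n::finite) set"
  assumes "growth_le Z d" "dense_in Z (difference_set X)" "d < CARD('s::finite)"
  shows "generic_linear (\<lambda>M :: 'k ^ 'n ^ 's. everywhere_identifiable (\<lambda>x. M *v x) X)"
proof -
  have "\<forall>j. \<exists>q :: 'k ^ ('s \<times> 'n) \<Rightarrow> 'k. is_poly q \<and> (\<exists>u. q u \<noteq> 0) \<and>
    (\<forall>u. \<forall>z\<in>difference_set X. z $ j \<noteq> 0 \<longrightarrow> matrix_of_vec u *v z = 0 \<longrightarrow> q u = 0)"
    using generic_matrix_avoids_kernel_param[OF assms] by blast
  from choice[OF this] obtain q where all: "\<forall>j. is_poly (q j) \<and> (\<exists>u. q j u \<noteq> 0) \<and>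
    (\<forall>u :: 'k ^ ('s \<times> 'n). \<forall>z\<in>difference_set X. z $ j \<noteq> 0 \<longrightarrow> matrix_of_vec u *v z = 0 \<longrightarrow> q j u = 0)" ..
  have q: "is_poly (q j)" "\<exists>u. q j u \<noteq> 0"
      "\<And>u z. z \<in> difference_set X \<Longrightarrow> z $ j \<noteq> 0 \<Longrightarrow> matrix_of_vec u *v z = 0 \<Longrightarrow> q j u = 0" for j
    using all by blast+
  define Q where "Q = (\<lambda>u. \<Prod>j\<in>UNIV. q j u)"
  have "is_poly Q" unfolding Q_def by (intro is_poly_intros q)
  then obtain p where p: "\<forall>u. Q u = mpoly_eval p u" unfolding is_poly_def by blast
  show ?thesis
    unfolding generic_linear_def
  proof (intro exI conjI ballI)
    show "zariski_open {u. Q u \<noteq> 0}"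
      unfolding zariski_open_def algebraic_set_def
      by (rule exI[of _ "{p}"]) (auto simp: p)
    have "\<exists>u. Q u \<noteq> 0"
      unfolding Q_def by (rule is_poly_prod_nonzero) (use q in auto)
    then show "{u. Q u \<noteq> 0} \<noteq> {}" by blast
    fix u assume u: "u \<in> {u. Q u \<noteq> 0}"
    show "everywhere_identifiable (\<lambda>x. matrix_of_vec u *v x) X"
      unfolding everywhere_identifiable_def identifiable_at_def
    proof (intro ballI equalityI subsetI)
      fix x y assume x: "x \<in> X" and "y \<in> {y \<in> X. matrix_of_vec u *v y = matrix_of_vec u *v x}"
      then have y: "y - x \<in> difference_set X" "matrix_of_vec u *v (y - x) = 0"
        by (auto simp: difference_set_def matrix_vector_mult_diff_distrib)
      have "(y - x) $ j = 0" for j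
      proof (rule ccontr)
        assume "(y - x) $ j \<noteq> 0"
        from q(3)[OF y(1) this y(2)] have "Q u = 0" unfolding Q_def by (intro prod_zero) auto
        then show False using u by simp
      qed
      then show "y \<in> {x}" by (auto simp: vec_eq_iff)
    qed auto
  qed
qed

section \<open>Difference sets\<close>

lemma dense_in_difference_set:
  fixes X :: "('k::comm_ring_1 ^ 'n::finite) set"
  assumes Z: "dense_in Z X"
  shows "dense_in (difference_set Z) (difference_set X)"
  unfolding dense_in_def
proof (intro allI impI ballI)
  fix f :: "'k ^ 'n \<Rightarrow> 'k" and w
  assume f: "is_poly f" and zero: "\<forall>w\<in>difference_set Z. f w = 0" and w: "w \<in> difference_set X"
  obtain x y where w: "w = x - y" "x \<in> X" "y \<in> X" using w by (auto simp: difference_set_def)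
  have "f (x - y) = 0" if y: "y \<in> Z" for y
  proof -
    have "is_poly (\<lambda>x. f (x - y))"
      by (rule is_poly_compose[OF f]) (simp add: is_poly_intros)
    moreover have "\<forall>x\<in>Z. f (x - y) = 0" using zero y by (auto simp: difference_set_def)
    ultimately show ?thesis using Z w(2) unfolding dense_in_def by blast
  qed
  moreover have "is_poly (\<lambda>y. f (x - y))"
    by (rule is_poly_compose[OF f]) (simp add: is_poly_intros)
  ultimately have "f (x - y) = 0" using Z w(3) unfolding dense_in_def by blast
  then show "f w = 0" by (simp add: w)
qed

text \<open>If \<open>f * g\<close> vanishes on all differences, then for each fixed \<open>y\<close> one of the two factors vanishes on
  \<open>X - y\<close>. Which one it is cannot depend on \<open>y\<close>, by irreducibility applied to \<open>f (x1 - y) * g (x2 - y)\<close> as a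
  function of \<open>y\<close>.\<close>

lemma zariski_irreducible_difference_set:
  fixes X :: "('k::comm_ring_1 ^ 'n::finite) set"
  assumes X: "zariski_irreducible X"
  shows "zariski_irreducible (difference_set X)"
proof -
  have irr: "(\<forall>x\<in>X. f x = 0) \<or> (\<forall>x\<in>X. g x = 0)"
    if "is_poly f" "is_poly g" "\<And>x. x \<in> X \<Longrightarrow> f x * g x = 0" for f g
    using X that unfolding zariski_irreducible_def by blast
  show ?thesis
    unfolding zariski_irreducible_def
  proof (intro conjI allI impI)
    obtain x where "x \<in> X" using X by (auto simp: zariski_irreducible_def)
    then have "x - x \<in> difference_set X" unfolding difference_set_def by blast
    then show "difference_set X \<noteq> {}" by blast
    fix f g :: "'k ^ 'n \<Rightarrow> 'k"
    assume f: "is_poly f" and g: "is_poly g" and fg: "\<forall>w\<in>difference_set X. f w * g w = 0"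
    have poly: "is_poly (\<lambda>x. h (x - y))" "is_poly (\<lambda>y. h (x - y))" if "is_poly h" for h :: "'k ^ 'n \<Rightarrow> 'k" and x y
      by (rule is_poly_compose[OF that], simp add: is_poly_intros)+
    have fg': "f (x - y) * g (x - y) = 0" if "x \<in> X" "y \<in> X" for x y
      using fg that by (auto simp: difference_set_def)
    have split: "(\<forall>x\<in>X. f (x - y) = 0) \<or> (\<forall>x\<in>X. g (x - y) = 0)" if "y \<in> X" for y
      by (rule irr) (use poly f g fg' that in auto)
    show "(\<forall>w\<in>difference_set X. f w = 0) \<or> (\<forall>w\<in>difference_set X. g w = 0)"
    proof (rule ccontr)
      assume "\<not> ?thesis"
      then obtain x1 y1 x2 y2 where *: "x1 \<in> X" "y1 \<in> X" "f (x1 - y1) \<noteq> 0" "x2 \<in> X" "y2 \<in> X" "g (x2 - y2) \<noteq> 0"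
        by (auto simp: difference_set_def)
      have "(\<forall>y\<in>X. f (x1 - y) = 0) \<or> (\<forall>y\<in>X. g (x2 - y) = 0)"
        by (rule irr) (use poly f g split *(1,4) in fastforce)+
      then show False using * by blast
    qed
  qed
qed

text \<open>A monomial in \<open>x - y\<close> expands into products of a monomial in \<open>x\<close> and one in \<open>y\<close>, so the
  Hilbert function of the difference set is at most the square of that of \<open>Z\<close>. The choice \<open>\<sigma>\<close> of a representation
  \<open>w = x - y\<close> turns functions of \<open>x\<close> and \<open>y\<close> into functions of \<open>w\<close>.\<close>

lemma growth_le_difference_set:
  fixes Z :: "('k::comm_ring_1 ^ 'n::finite) set"
  assumes "growth_le Z d"
  shows "growth_le (difference_set Z) (2 * d)"
proof -
  obtain C where C: "\<And>K. \<exists>H. finite H \<and> card H \<le> C * (K + 1) ^ d \<and>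
     (\<forall>e\<in>exp_box UNIV K. lincomb_on Z H (monom_fun e))"
    using assms unfolding growth_le_def by blast
  have "\<forall>w\<in>difference_set Z. \<exists>p. p \<in> Z \<times> Z \<and> w = fst p - snd p"
    unfolding difference_set_def by force
  from bchoice[OF this] obtain \<sigma> where \<sigma>: "\<forall>w\<in>difference_set Z. \<sigma> w \<in> Z \<times> Z \<and> w = fst (\<sigma> w) - snd (\<sigma> w)" ..
  show ?thesis
    unfolding growth_le_def
  proof (rule exI, rule allI)
    fix K
    define L where "L = CARD('n) * K"
    obtain H where H: "finite H" "card H \<le> C * (L + 1) ^ d"
        "\<And>e. e \<in> exp_box UNIV L \<Longrightarrow> lincomb_on Z H (monom_fun e)"
      using C[of L] by blast
    define H' where "H' = (\<lambda>(h1, h2) w. h1 (fst (\<sigma> w)) * h2 (snd (\<sigma> w))) ` (H \<times> H)"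
    have fin: "finite H'" using H(1) by (simp add: H'_def)
    have "card H' \<le> card H * card H"
      unfolding H'_def card_cartesian_product[symmetric] using H(1) by (intro card_image_le) simp
    also have "\<dots> \<le> (C * (L + 1) ^ d) * (C * (L + 1) ^ d)"
      using H(2) by (intro mult_mono) auto
    also have "\<dots> = C * C * (L + 1) ^ (2 * d)"
      unfolding mult_2 power_add by (simp only: mult_ac)
    also have "\<dots> \<le> C * C * ((CARD('n) + 1) * (K + 1)) ^ (2 * d)"
      by (intro mult_left_mono power_mono) (auto simp: L_def)
    also have "\<dots> = C * C * (CARD('n) + 1) ^ (2 * d) * (K + 1) ^ (2 * d)"
      unfolding power_mult_distrib by (simp only: mult_ac)
    finally have card: "card H' \<le> C * C * (CARD('n) + 1) ^ (2 * d) * (K + 1) ^ (2 * d)" .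
    have "lincomb_on (difference_set Z) H' (monom_fun e)" if e: "e \<in> exp_box UNIV K" for e
    proof -
      have coord: "lincomb_on UNIV (pair_monoms UNIV UNIV 1) (\<lambda>q :: ('k ^ 'n) \<times> ('k ^ 'n). (fst q - snd q) $ i)" for i
      proof -
        have "lincomb_on UNIV (pair_monoms UNIV UNIV 1) (\<lambda>q :: ('k ^ 'n) \<times> ('k ^ 'n). fst q $ i + (- 1) * snd q $ i)"
          by (intro lincomb_on_add lincomb_on_scale pair_monoms_fst pair_monoms_snd) auto
        then show ?thesis by simp
      qed
      have "(\<Sum>i\<in>UNIV. e i) \<le> (\<Sum>i\<in>(UNIV :: 'n set). K)"
        by (rule sum_mono) (use e in \<open>auto simp: exp_box_def\<close>)
      then have "(\<Sum>i\<in>UNIV. e i) \<le> L" by (simp add: L_def)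
      then have "lincomb_on UNIV (pair_monoms UNIV UNIV L) (\<lambda>q :: ('k ^ 'n) \<times> ('k ^ 'n). monom_fun e (fst q - snd q))"
        using lincomb_on_mono[OF pair_monoms_monom[OF coord] pair_monoms_mono] by simp
      then obtain c where c: "\<And>q :: ('k ^ 'n) \<times> ('k ^ 'n). monom_fun e (fst q - snd q)
          = (\<Sum>m\<in>pair_monoms UNIV UNIV L. c m * m q)"
        unfolding lincomb_on_def by blast
      have "lincomb_on (difference_set Z) H' (\<lambda>w. \<Sum>m\<in>pair_monoms UNIV UNIV L. c m * m (\<sigma> w))"
      proof (intro lincomb_on_sum lincomb_on_scale)
        fix m :: "('k ^ 'n) \<times> ('k ^ 'n) \<Rightarrow> 'k" assume "m \<in> pair_monoms UNIV UNIV L"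
        then obtain a b where m: "m = (\<lambda>(x, y). monom_fun a x * monom_fun b y)"
          and ab: "a \<in> exp_box UNIV L" "b \<in> exp_box UNIV L"
          by (auto simp: pair_monoms_def)
        obtain s where s: "\<forall>z\<in>Z. monom_fun a z = (\<Sum>h\<in>H. s h * h z)"
          using H(3)[OF ab(1)] unfolding lincomb_on_def by blast
        obtain t where t: "\<forall>z\<in>Z. monom_fun b z = (\<Sum>h\<in>H. t h * h z)"
          using H(3)[OF ab(2)] unfolding lincomb_on_def by blast
        have "lincomb_on (difference_set Z) H'
          (\<lambda>w. \<Sum>h1\<in>H. \<Sum>h2\<in>H. s h1 * (t h2 * (h1 (fst (\<sigma> w)) * h2 (snd (\<sigma> w)))))"
          by (intro lincomb_on_sum lincomb_on_scale lincomb_on_base fin) (force simp: H'_def)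
        then show "lincomb_on (difference_set Z) H' (\<lambda>w. m (\<sigma> w))"
        proof (rule lincomb_on_cong[rotated])
          fix w assume "w \<in> difference_set Z"
          then have "fst (\<sigma> w) \<in> Z" "snd (\<sigma> w) \<in> Z" using \<sigma> by (auto simp: mem_Times_iff)
          then show "(\<Sum>h1\<in>H. \<Sum>h2\<in>H. s h1 * (t h2 * (h1 (fst (\<sigma> w)) * h2 (snd (\<sigma> w))))) = m (\<sigma> w)"
            using s t by (simp add: m case_prod_unfold sum_product mult_ac)
        qed
      qed
      then show ?thesis
      proof (rule lincomb_on_cong[rotated])
        fix w assume "w \<in> difference_set Z"
        then have "fst (\<sigma> w) - snd (\<sigma> w) = w" using \<sigma> by metis
        then show "(\<Sum>m\<in>pair_monoms UNIV UNIV L. c m * m (\<sigma> w)) = monom_fun e w"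
          using c[of "\<sigma> w"] by simp
      qed
    qed
    then show "\<exists>H. finite H \<and> card H \<le> C * C * (CARD('n) + 1) ^ (2 * d) * (K + 1) ^ (2 * d) \<and>
        (\<forall>e\<in>exp_box UNIV K. lincomb_on (difference_set Z) H (monom_fun e))"
      using fin card by blast
  qed
qed

section \<open>Generic identifiability\<close>

lemma zariski_irreducible_of_irreducible_set:
  fixes X :: "('k::idom ^ 'n::finite) set"
  assumes "algebraic_set X" "irreducible_set X"
  shows "zariski_irreducible X"
  unfolding zariski_irreducible_def
proof (intro conjI allI impI)
  show "X \<noteq> {}" using assms(2) by (simp add: irreducible_set_def)
  fix f g :: "'k ^ 'n \<Rightarrow> 'k"
  assume fg: "is_poly f" "is_poly g" "\<forall>x\<in>X. f x * g x = 0"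
  obtain F where F: "finite F" "X = {x. \<forall>p\<in>F. mpoly_eval p x = 0}"
    using assms(1) unfolding algebraic_set_def by blast
  have alg: "algebraic_set {x\<in>X. h x = 0}" if "is_poly h" for h
  proof -
    obtain p where "\<forall>x. h x = mpoly_eval p x" using \<open>is_poly h\<close> unfolding is_poly_def by blast
    then show ?thesis
      unfolding algebraic_set_def using F by (intro exI[of _ "insert p F"]) auto
  qed
  have "X = {x\<in>X. f x = 0} \<union> {x\<in>X. g x = 0}"
    using fg(3) by auto
  then have "\<not> {x\<in>X. f x = 0} \<subset> X \<or> \<not> {x\<in>X. g x = 0} \<subset> X"
    using assms(2) alg[OF fg(1)] alg[OF fg(2)] unfolding irreducible_set_def by blast
  then show "(\<forall>x\<in>X. f x = 0) \<or> (\<forall>x\<in>X. g x = 0)" by blast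
qed

lemma zariski_irreducible_range:
  fixes h :: "'k::field_char_0 ^ 'l::finite \<Rightarrow> 'k ^ 'n::finite"
  assumes "polynomial_map h"
  shows "zariski_irreducible (range h)"
  unfolding zariski_irreducible_def
proof (intro conjI allI impI)
  fix f g :: "'k ^ 'n \<Rightarrow> 'k"
  assume fg: "is_poly f" "is_poly g" "\<forall>x\<in>range h. f x * g x = 0"
  obtain p where p: "\<forall>t. h t = (\<chi> i. mpoly_eval (p i) t)"
    using assms unfolding polynomial_map_def by blast
  have h: "is_poly (\<lambda>t. h t $ i)" for i using p by (simp add: is_poly_intros)
  show "(\<forall>x\<in>range h. f x = 0) \<or> (\<forall>x\<in>range h. g x = 0)"
  proof (rule ccontr)
    assume "\<not> ?thesis"
    then obtain t u where "f (h t) \<noteq> 0" "g (h u) \<noteq> 0" by blast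
    from is_poly_no_zero_divisors[OF is_poly_compose[OF fg(1) h] is_poly_compose[OF fg(2) h] this]
    show False using fg(3) by auto
  qed
qed simp

lemma generic_identifiability:
  fixes X :: "('k::real_normed_field ^ 'n::finite) set"
  assumes X: "zariski_irreducible X"
    and dim: "enat CARD('s::finite) \<ge> 1 + alg_dim (difference_set X) \<or> enat CARD('s) \<ge> 2 * alg_dim X + 1"
  shows "generic_linear (\<lambda>M :: 'k ^ 'n ^ 's. everywhere_identifiable (\<lambda>x. M *v x) X)"
  using dim
proof
  assume le: "enat CARD('s) \<ge> 1 + alg_dim (difference_set X)"
  then obtain d where d: "alg_dim (difference_set X) = enat d" by (cases "alg_dim (difference_set X)") auto
  then have "d < CARD('s)" using le by (simp add: one_enat_def)
  moreover obtain Z where "dense_in Z (difference_set X)" "growth_le Z d"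
    using growth_le_of_alg_dim_le[OF zariski_irreducible_difference_set[OF X], of d] d by auto
  ultimately show ?thesis by (intro generic_linear_everywhere_identifiable)
next
  assume le: "enat CARD('s) \<ge> 2 * alg_dim X + 1"
  then obtain d where d: "alg_dim X = enat d" by (cases "alg_dim X") (auto simp: numeral_eq_enat)
  then have "2 * d < CARD('s)" using le by (simp add: one_enat_def numeral_eq_enat)
  moreover obtain Z where "dense_in Z X" "growth_le Z d"
    using growth_le_of_alg_dim_le[OF X, of d] d by auto
  ultimately show ?thesis
    by (intro generic_linear_everywhere_identifiable[OF growth_le_difference_set dense_in_difference_set])
qed

theorem mainTheorem10:
  shows
    "(\<forall>\<X> :: (real ^ 'n) set.
        (algebraic_set \<X> \<and> irreducible_set \<X>) \<or>
        (\<exists>h :: real ^ 'l \<Rightarrow> real ^ 'n. polynomial_map h \<and> \<X> = range h) \<longrightarrow>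
        (enat CARD('s) \<ge> 1 + alg_dim (difference_set \<X>) \<longrightarrow>
           generic_linear (\<lambda>M :: real ^ 'n ^ 's. everywhere_identifiable (\<lambda>x. M *v x) \<X>)) \<and>
        (enat CARD('s) \<ge> 2 * alg_dim \<X> + 1 \<longrightarrow>
           generic_linear (\<lambda>M :: real ^ 'n ^ 's. everywhere_identifiable (\<lambda>x. M *v x) \<X>)))
     \<and>
     (\<forall>\<X> :: (complex ^ 'n) set.
        (algebraic_set \<X> \<and> irreducible_set \<X>) \<or>
        (\<exists>h :: complex ^ 'l \<Rightarrow> complex ^ 'n. polynomial_map h \<and> \<X> = range h) \<longrightarrow>
        (enat CARD('s) \<ge> 1 + alg_dim (difference_set \<X>) \<longrightarrow>
           generic_linear (\<lambda>M :: complex ^ 'n ^ 's. everywhere_identifiable (\<lambda>x. M *v x) \<X>)) \<and>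
        (enat CARD('s) \<ge> 2 * alg_dim \<X> + 1 \<longrightarrow>
           generic_linear (\<lambda>M :: complex ^ 'n ^ 's. everywhere_identifiable (\<lambda>x. M *v x) \<X>)))"
proof (intro conjI allI impI)
  fix X :: "(real ^ 'n) set"
  assume "(algebraic_set X \<and> irreducible_set X) \<or> (\<exists>h :: real ^ 'l \<Rightarrow> real ^ 'n. polynomial_map h \<and> X = range h)"
  then have X: "zariski_irreducible X"
    using zariski_irreducible_of_irreducible_set zariski_irreducible_range by blast
  show "generic_linear (\<lambda>M :: real ^ 'n ^ 's. everywhere_identifiable (\<lambda>x. M *v x) X)"
    if "enat CARD('s) \<ge> 1 + alg_dim (difference_set X)"
    using generic_identifiability[OF X] that by blast
  show "generic_linear (\<lambda>M :: real ^ 'n ^ 's. everywhere_identifiable (\<lambda>x. M *v x) X)"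
    if "enat CARD('s) \<ge> 2 * alg_dim X + 1"
    using generic_identifiability[OF X] that by blast
next
  fix X :: "(complex ^ 'n) set"
  assume "(algebraic_set X \<and> irreducible_set X) \<or> (\<exists>h :: complex ^ 'l \<Rightarrow> complex ^ 'n. polynomial_map h \<and> X = range h)"
  then have X: "zariski_irreducible X"
    using zariski_irreducible_of_irreducible_set zariski_irreducible_range by blast
  show "generic_linear (\<lambda>M :: complex ^ 'n ^ 's. everywhere_identifiable (\<lambda>x. M *v x) X)"
    if "enat CARD('s) \<ge> 1 + alg_dim (difference_set X)"
    using generic_identifiability[OF X] that by blast
  show "generic_linear (\<lambda>M :: complex ^ 'n ^ 's. everywhere_identifiable (\<lambda>x. M *v x) X)"
    if "enat CARD('s) \<ge> 2 * alg_dim X + 1"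
    using generic_identifiability[OF X] that by blast
qed

end
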